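(* For all $l,m\in\mathbb{N}$ there exists a pair of rational symmetric formulas $(d^{l,m},s^{l,m})\in\mathscr{S}_{\mathbb{Q}}^2$ such that $$\tau(d^{l,m})=l+1,\qquad \tau(s^{l,m})=m,\qquad \sum_{j\in\mathbb{Z}}d^{l,m}_j\,j^2=-2,$$ which solves the optimization problem $$\max_{\substack{(d,s)\in\mathscr{S}_{\mathbb{C}}^2\setminus\{(0,0)\}\\ \tau(d)\le l+1,\ \tau(s)\le m}}\operatorname{ord}(d,s)=\operatorname{ord}(d^{l,m},s^{l,m})=2(l+m+1).$$ Moreover, if $(d,s)\in\mathscr{S}_{\mathbb{C}}^2$ satisfies $\tau(d)\le l+1$, $\tau(s)\le m$ and $\operatorname{ord}(d,s)=2(l+m+1)$, then there exists $\lambda\in\mathbb{C}$ such that $d=\lambda d^{l,m}$ and $s=\lambda s^{l,m}$.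
   Context: $\mathbb{N}=\{0,1,2,\dots\}$. For a ring $R$ with $\mathbb{Z}\subset R\subset\mathbb{C}$, $\mathscr{S}_R$ is the set of finitely supported sequences $b=(b_j)_{j\in\mathbb{Z}}$ with values in $R$ that are symmetric: $b_j=b_{-j}$ for all $j$. For $b\in\mathscr{S}_{\mathbb{C}}$, $\tau(b)=\max\{j\in\mathbb{Z}: b_j\ne0\}$, with the convention $\tau(0)=-\infty$. For $n\in 2\mathbb{N}$, a pair $(d,s)\in\mathscr{S}_{\mathbb{C}}^2$ is consistent of order $n$ if for every $u\in C^\infty(\mathbb{R})$, $\sum_{j\in\mathbb{Z}}\big(d_j u(jh)+h^2 s_j u''(jh)\big)=\mathcal{O}(h^{n+2})$ as $h\to0^+$. The exact order is $\operatorname{ord}(d,s)=\sup\{n\in2\mathbb{N}: (d,s)\text{ is consistent of order }n\}$ (supremum of the empty set being $-\infty$). *)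

theory Defs
  imports "HOL-Analysis.Analysis" "HOL-Library.Landau_Symbols"
begin

definition sym_formulas :: "complex set \<Rightarrow> (int \<Rightarrow> complex) set" where
  "sym_formulas R =
     {b. finite {j. b j \<noteq> 0} \<and> (\<forall>j. b j \<in> R) \<and> (\<forall>j. b (- j) = b j)}"

definition tau :: "(int \<Rightarrow> complex) \<Rightarrow> ereal" where
  "tau b = (if b = (\<lambda>_. 0) then -\<infinity> else ereal (of_int (Max {j. b j \<noteq> 0})))"

definition nth_deriv :: "nat \<Rightarrow> (real \<Rightarrow> complex) \<Rightarrow> real \<Rightarrow> complex" where
  "nth_deriv k u = ((\<lambda>f x. vector_derivative f (at x)) ^^ k) u"

definition smooth :: "(real \<Rightarrow> complex) \<Rightarrow> bool" where
  "smooth u \<longleftrightarrow> (\<forall>k x. nth_deriv k u differentiable (at x))"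

definition consistent :: "nat \<Rightarrow> (int \<Rightarrow> complex) \<Rightarrow> (int \<Rightarrow> complex) \<Rightarrow> bool" where
  "consistent n d s \<longleftrightarrow>
     (\<forall>u. smooth u \<longrightarrow>
       (\<lambda>h. \<Sum>\<^sub>\<infinity>j. d j * u (of_int j * h) + of_real (h ^ 2) * s j * nth_deriv 2 u (of_int j * h))
         \<in> O[at_right 0](\<lambda>h. of_real (h ^ (n + 2))))"

text \<open>In \<^typ>\<open>ereal\<close> the supremum of the empty set is \<open>-\<infinity>\<close>.\<close>

definition exact_ord :: "(int \<Rightarrow> complex) \<Rightarrow> (int \<Rightarrow> complex) \<Rightarrow> ereal" where
  "exact_ord d s = (SUP n \<in> {n. even n \<and> consistent n d s}. ereal (real n))"

definition admissible :: "nat \<Rightarrow> nat \<Rightarrow> ((int \<Rightarrow> complex) \<times> (int \<Rightarrow> complex)) set" where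
  "admissible l m =
     {(d, s) \<in> sym_formulas UNIV \<times> sym_formulas UNIV - {(\<lambda>_. 0, \<lambda>_. 0)}.
        tau d \<le> ereal (real (l + 1)) \<and> tau s \<le> ereal (real m)}"

end

theory Submission
  imports Defs "HOL-Computational_Algebra.Polynomial_FPS"
begin

text \<open>
  Consistency is a condition on moments. Taylor expansion shows that \<open>(d, s)\<close> is consistent of
  order \<open>n\<close> iff \<open>\<Sum>\<^sub>j (d\<^sub>j j^k / k! + s\<^sub>j j^(k-2) / (k-2)!)\<close> vanishes for all \<open>k < n + 2\<close>, the second
  term being absent for \<open>k < 2\<close> (\<open>consistent_imp_formula_moment\<close>, \<open>formula_moment_imp_consistent\<close>). By symmetry only even \<open>k\<close>
  matter, so for \<open>n = 2(l + m + 1)\<close> there are \<open>l + m + 2\<close> rational linear equations in the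
  \<open>l + m + 3\<close> unknowns \<open>d\<^sub>0, ..., d\<^sub>l\<^sub>+\<^sub>1, s\<^sub>0, ..., s\<^sub>m\<close>, and a nonzero rational solution exists. All
  other claims follow if the solution is rigid: a solution must be zero as soon as one
  more equation is imposed, be it the next moment, \<open>d\<^sub>l\<^sub>+\<^sub>1 = 0\<close>, \<open>s\<^sub>m = 0\<close> or \<open>\<Sum>\<^sub>j s\<^sub>j = 0\<close>. The last one
  gives uniqueness up to scaling and the normalisation, as the moment of index 2 reads
  \<open>\<Sum>\<^sub>j d\<^sub>j j^2 = -2 \<Sum>\<^sub>j s\<^sub>j\<close>.

  Rigidity is a statement about Pade approximation. In the variable \<open>t = sin^2(\<xi>/2)\<close> the functions
  \<open>\<Sum>\<^sub>j d\<^sub>j cos(j\<xi>)\<close> and \<open>\<Sum>\<^sub>j s\<^sub>j cos(j\<xi>)\<close> become polynomials \<open>P\<close> and \<open>Q\<close> of degrees at most \<open>l + 1\<close> and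
  \<open>m\<close>, and \<open>\<xi>^2\<close> becomes \<open>F(t) = 4 arcsin^2(sqrt t)\<close>. The moment equations say that \<open>P - F Q\<close>
  vanishes to order \<open>l + m + 2\<close> at \<open>t = 0\<close> (\<open>even_moment_pade\<close>). Thus \<open>P/Q\<close> is a Pade approximant of
  \<open>F\<close>, and what is needed is that the Pade table of \<open>F(t)/t\<close> is normal (\<open>pade_table_normal\<close>).

  Normality comes from positivity. The coefficients of \<open>F(t)/(4t)\<close> are the moments \<open>L(X^k)\<close> of the
  functional \<open>L(p) = \<integral>\<integral> p(r(1 - v^2)) dr dv\<close> over the unit square, which is positive on nonzero polynomials
  that are nonnegative on \<open>[0,1]\<close>. If the numerator has at least as many coefficients as the
  denominator, the conditions on the denominator form a Hankel system with a positive
  definite matrix. In the opposite case the same argument is applied to the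
  reciprocal series \<open>4t/F(t)\<close>. From index 2 on, its negated coefficients are again Gram matrix entries,
  because they arise from compressing multiplication by \<open>X\<close> to the orthogonal complement of the
  constants (\<open>moment_functional_recip_product\<close>).
\<close>

section \<open>A positive functional on polynomials\<close>

lemma graded_family_independent:
  fixes u :: "nat \<Rightarrow> 'a::idom poly"
  assumes "\<And>i. i < n \<Longrightarrow> degree (u i) = i + r" and "\<And>i. i < n \<Longrightarrow> u i \<noteq> 0"
    and "(\<Sum>i<n. smult (x i) (u i)) = 0"
  shows "\<forall>i<n. x i = 0"
  using assms
proof (induction n)
  case (Suc n)
  have "coeff (smult (x i) (u i)) (n + r) = 0" if "i < n" for i
    using that Suc.prems(1)[of i] by (simp add: coeff_eq_0)
  then have "coeff (\<Sum>i<n. smult (x i) (u i)) (n + r) = 0"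
    unfolding coeff_sum by (intro sum.neutral) simp
  moreover have "coeff (\<Sum>i<Suc n. smult (x i) (u i)) (n + r) = 0"
    unfolding Suc.prems(3) by simp
  ultimately have "x n * lead_coeff (u n) = 0"
    using Suc.prems(1)[of n] by simp
  then have "x n = 0"
    using Suc.prems(2)[of n] by simp
  then show ?case
    using Suc by (simp add: less_Suc_eq)
qed simp

text \<open>
  These are the Taylor coefficients of \<open>arcsin^2(sqrt t) / t\<close>; the recursion is the one that the
  differential equation \<open>sq_fps_ode\<close> below dictates.
\<close>

primrec arcsin_moment :: "nat \<Rightarrow> real" where
  "arcsin_moment 0 = 1"
| "arcsin_moment (Suc k) = arcsin_moment k * (real k + 1)\<^sup>2 / ((real k + 2) * (real k + 3 / 2))"

definition moment_functional :: "real poly \<Rightarrow> real" where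
  "moment_functional p = (\<Sum>k\<le>degree p. coeff p k * arcsin_moment k)"

lemma moment_functional_altdef:
  assumes "degree p \<le> n"
  shows "moment_functional p = (\<Sum>k\<le>n. coeff p k * arcsin_moment k)"
  unfolding moment_functional_def
  by (rule sum.mono_neutral_left) (use assms in \<open>auto simp: coeff_eq_0\<close>)

lemma moment_functional_add: "moment_functional (p + q) = moment_functional p + moment_functional q"
proof -
  define n where "n = max (degree p) (degree q)"
  have "degree p \<le> n" "degree q \<le> n" "degree (p + q) \<le> n"
    by (auto simp: n_def degree_add_le_max)
  then show ?thesis
    by (simp add: moment_functional_altdef[where n = n] sum.distrib algebra_simps)
qed

lemma moment_functional_smult: "moment_functional (smult a p) = a * moment_functional p"
  by (simp add: moment_functional_altdef[where n = "degree p"] sum_distrib_left mult.assoc)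

lemma moment_functional_0 [simp]: "moment_functional 0 = 0"
  by (simp add: moment_functional_def)

lemma moment_functional_sum: "moment_functional (\<Sum>i\<in>A. p i) = (\<Sum>i\<in>A. moment_functional (p i))"
  by (induction A rule: infinite_finite_induct) (auto simp: moment_functional_add)

lemma moment_functional_monom: "moment_functional (monom 1 k) = arcsin_moment k"
  by (simp add: moment_functional_altdef[where n = k] degree_monom_eq of_bool_def if_distrib[of "\<lambda>x. x * _"] cong: if_cong)

lemma moment_functional_pCons: "moment_functional (pCons a p) = a + moment_functional (pCons 0 p)"
proof -
  have "pCons a p = smult a (monom 1 0) + pCons 0 p"
    by (simp add: monom_0)
  then show ?thesis
    by (metis moment_functional_add moment_functional_smult moment_functional_monom arcsin_moment.simps(1) mult.right_neutral)
qed

lemma has_integral_monomial_unit: "((\<lambda>r::real. r ^ k) has_integral 1 / (real k + 1)) {0..1}"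
proof -
  have "((\<lambda>r. r ^ Suc k / (real k + 1)) has_real_derivative t ^ k) (at t within {0..1})" for t :: real
    using add_pos_nonneg[of 1 "real k"] by (auto intro!: derivative_eq_intros simp: divide_simps simp del: power_Suc)
  then have "((\<lambda>r::real. r ^ k) has_integral (1 ^ Suc k / (real k + 1) - 0 ^ Suc k / (real k + 1))) {0..1}"
    by (intro fundamental_theorem_of_calculus)
      (auto simp: has_real_derivative_iff_has_vector_derivative[symmetric])
  then show ?thesis by simp
qed

text \<open>
  The integral \<open>I\<^sub>k\<close> of \<open>(1 - v^2)^k\<close> over \<open>[0,1]\<close> satisfies \<open>(2k + 3) I\<^sub>k\<^sub>+\<^sub>1 = 2 (k + 1) I\<^sub>k\<close>, by integration by
  parts: the derivative of \<open>v (1 - v^2)^(k+1)\<close> integrates to zero. The factor \<open>1 / (k + 1)\<close> missing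
  from \<open>I\<^sub>k\<close> is the integral of \<open>r^k\<close>, so \<open>arcsin_moment k\<close> is the double integral of \<open>(r (1 - v^2))^k\<close>.
\<close>

lemma has_integral_arcsin_moment:
  "((\<lambda>v::real. (1 - v\<^sup>2) ^ k) has_integral (real k + 1) * arcsin_moment k) {0..1}"
proof (induction k)
  case 0
  show ?case using has_integral_const_real[of "1::real" 0 1] by simp
next
  case (Suc k)
  \<comment> \<open>the derivative of \<open>v (1 - v^2)^(k+1)\<close>\<close>
  define g :: "real \<Rightarrow> real" where "g = (\<lambda>v. (1 - v\<^sup>2) ^ Suc k - 2 * (real k + 1) * v\<^sup>2 * (1 - v\<^sup>2) ^ k)"
  have "(g has_integral (1 * (1 - 1\<^sup>2) ^ Suc k - 0 * (1 - 0\<^sup>2) ^ Suc k)) {0..1}"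
    unfolding g_def
    by (rule fundamental_theorem_of_calculus)
      (auto intro!: derivative_eq_intros simp del: power_Suc
        simp: has_real_derivative_iff_has_vector_derivative[symmetric] algebra_simps power2_eq_square)
  then have "(g has_integral 0) {0..1}"
    by simp
  from has_integral_add[OF this has_integral_mult_right[OF Suc, of "2 * (real k + 1)"]]
  have "((\<lambda>v. g v + 2 * (real k + 1) * (1 - v\<^sup>2) ^ k) has_integral
      2 * (real k + 1)\<^sup>2 * arcsin_moment k) {0..1}"
    by (simp add: power2_eq_square algebra_simps)
  also have "(\<lambda>v. g v + 2 * (real k + 1) * (1 - v\<^sup>2) ^ k) = (\<lambda>v. (2 * real k + 3) * (1 - v\<^sup>2) ^ Suc k)"
    by (auto simp: g_def algebra_simps)
  finally have "((\<lambda>v. 1 / (2 * real k + 3) * ((2 * real k + 3) * (1 - v\<^sup>2) ^ Suc k)) has_integral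
      1 / (2 * real k + 3) * (2 * (real k + 1)\<^sup>2 * arcsin_moment k)) {0..1}"
    by (rule has_integral_mult_right)
  moreover have "1 / (2 * real k + 3) * (2 * (real k + 1)\<^sup>2 * arcsin_moment k)
      = (real (Suc k) + 1) * arcsin_moment (Suc k)"
  proof -
    have "2 * real k + 3 \<noteq> 0" "real k + 2 \<noteq> 0" by linarith+
    then show ?thesis by (simp add: divide_simps)(simp add: algebra_simps)
  qed
  moreover have "1 / (2 * real k + 3) * ((2 * real k + 3) * c) = c" for c :: real
  proof -
    have "2 * real k + 3 \<noteq> 0" by linarith
    then show ?thesis by simp
  qed
  ultimately show ?case by simp
qed

text \<open>
  The functional integrates \<open>p(r (1 - v^2))\<close> over the unit square. If \<open>p\<close> is nonnegative on \<open>[0,1]\<close> and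
  the integral is zero, then already the slice \<open>v = 0\<close> forces \<open>p\<close> to vanish on \<open>[0,1]\<close>.
\<close>

lemma moment_functional_pos:
  assumes nonneg: "\<And>t. 0 \<le> t \<Longrightarrow> t \<le> 1 \<Longrightarrow> 0 \<le> poly p t" and "p \<noteq> 0"
  shows "moment_functional p > 0"
proof -
  \<comment> \<open>the inner integral over \<open>r\<close>, as a function of \<open>v\<close>\<close>
  define g where "g = (\<lambda>v::real. \<Sum>k\<le>degree p. (coeff p k / (real k + 1)) * (1 - v\<^sup>2) ^ k)"
  have inner: "((\<lambda>r. poly p (r * (1 - v\<^sup>2))) has_integral g v) {0..1}" for v
  proof -
    have "((\<lambda>r. \<Sum>k\<le>degree p. (coeff p k * (1 - v\<^sup>2) ^ k) * r ^ k) has_integral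
        (\<Sum>k\<le>degree p. (coeff p k * (1 - v\<^sup>2) ^ k) * (1 / (real k + 1)))) {0..1}"
      by (intro has_integral_sum has_integral_mult_right has_integral_monomial_unit) auto
    then show ?thesis
      by (simp add: g_def poly_altdef power_mult_distrib mult_ac)
  qed
  have "(g has_integral (\<Sum>k\<le>degree p. (coeff p k / (real k + 1)) * ((real k + 1) * arcsin_moment k))) {0..1}"
    unfolding g_def by (intro has_integral_sum has_integral_mult_right has_integral_arcsin_moment) auto
  moreover have "(coeff p k / (real k + 1)) * ((real k + 1) * arcsin_moment k) = coeff p k * arcsin_moment k" for k
  proof -
    have "real k + 1 \<noteq> 0" by linarith
    then show ?thesis by simp
  qed
  ultimately have outer: "(g has_integral moment_functional p) {0..1}"
    by (simp add: moment_functional_def)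
  have g_nonneg: "0 \<le> g v" if "v \<in> {0..1}" for v
  proof (rule has_integral_nonneg[OF inner])
    fix r :: real assume "r \<in> {0..1}"
    moreover have "0 \<le> 1 - v\<^sup>2" "1 - v\<^sup>2 \<le> 1"
      using that by (auto simp: power_le_one)
    ultimately show "0 \<le> poly p (r * (1 - v\<^sup>2))"
      by (intro nonneg) (auto intro: mult_le_one)
  qed
  have "moment_functional p \<noteq> 0"
  proof
    assume "moment_functional p = 0"
    moreover have cont: "continuous_on {0..1} g"
      unfolding g_def by (intro continuous_intros)
    ultimately have "g 0 = 0"
      using integral_eq_0_iff[OF cont] g_nonneg outer by (simp add: integral_unique)
    then have "((\<lambda>r. poly p r) has_integral 0) {0..1}"
      using inner[of 0] by simp
    moreover have "continuous_on {0..1} (poly p)"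
      by (intro continuous_intros)
    ultimately have "\<forall>r\<in>{0..1}. poly p r = 0"
      using integral_eq_0_iff[of 0 1 "poly p"] nonneg by (simp add: integral_unique)
    then have "{0..1} \<subseteq> {r. poly p r = 0}"
      by auto
    then have "finite {0..1::real}"
      using poly_roots_finite[OF \<open>p \<noteq> 0\<close>] finite_subset by blast
    then show False using infinite_Icc[of "0::real" 1] by simp
  qed
  moreover have "0 \<le> moment_functional p"
    by (rule has_integral_nonneg[OF outer g_nonneg])
  ultimately show ?thesis by simp
qed

text \<open>
  The quadratic form is \<open>L(X^s p^2)\<close> for \<open>p = \<Sum>\<^sub>i x\<^sub>i u\<^sub>i\<close>, and a graded family is linearly independent.
\<close>

lemma moment_functional_gram_definite:
  assumes "\<And>i. i < n \<Longrightarrow> degree (u i) = i + r" and "\<And>i. i < n \<Longrightarrow> u i \<noteq> 0"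
    and "(\<Sum>i<n. \<Sum>j<n. x i * x j * moment_functional (monom 1 s * u i * u j)) = 0"
  shows "\<forall>i<n. x i = 0"
proof -
  define p where "p = (\<Sum>i<n. smult (x i) (u i))"
  have "p\<^sup>2 = (\<Sum>i<n. \<Sum>j<n. smult (x i * x j) (u i * u j))"
    by (simp add: p_def power2_eq_square sum_product mult_ac)
  then have "monom 1 s * p\<^sup>2 = (\<Sum>i<n. \<Sum>j<n. smult (x i * x j) (monom 1 s * u i * u j))"
    by (simp add: sum_distrib_left mult.assoc)
  then have "moment_functional (monom 1 s * p\<^sup>2) = 0"
    using assms(3) by (simp add: moment_functional_sum moment_functional_smult)
  moreover have "0 \<le> poly (monom 1 s * p\<^sup>2) t" if "0 \<le> t" for t
    using that by (simp add: poly_monom)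
  ultimately have "monom 1 s * p\<^sup>2 = 0"
    using moment_functional_pos[of "monom 1 s * p\<^sup>2"] by force
  then have "p = 0"
    by (simp add: monom_eq_0_iff)
  then show ?thesis
    using graded_family_independent[of n u r x] assms(1,2) by (simp add: p_def)
qed

lemma hankel_arcsin_moment_definite:
  assumes "(\<Sum>i<n. \<Sum>j<n. x i * x j * arcsin_moment (s + i + j)) = 0"
  shows "\<forall>i<n. x i = 0"
proof (rule moment_functional_gram_definite[where u = "\<lambda>i. monom 1 i" and r = 0 and s = s])
  show "(\<Sum>i<n. \<Sum>j<n. x i * x j * moment_functional (monom 1 s * monom 1 i * monom 1 j)) = 0"
    using assms by (simp add: mult_monom moment_functional_monom)
qed (simp_all add: degree_monom_eq monom_eq_0_iff)

section \<open>The reciprocal series\<close>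

text \<open>
  The polynomial \<open>recip_poly (Suc k)\<close> is \<open>X * recip_poly k\<close> minus its \<open>L\<close>-projection to the constants.
  Its coefficients, read from the top, are the first coefficients of the reciprocal of the power
  series \<open>\<Sum>\<^sub>k L(X^k) t^k\<close>, independently of \<open>k\<close>, since each step only adds a new constant term.
\<close>

primrec recip_poly :: "nat \<Rightarrow> real poly" where
  "recip_poly 0 = 1"
| "recip_poly (Suc k) = pCons (- moment_functional (pCons 0 (recip_poly k))) (recip_poly k)"

definition recip_coeff :: "nat \<Rightarrow> real" where
  "recip_coeff k = coeff (recip_poly k) 0"

lemma recip_poly_Suc: "recip_poly (Suc k) = pCons (recip_coeff (Suc k)) (recip_poly k)"
  by (simp add: recip_coeff_def)

lemma recip_coeff_Suc: "recip_coeff (Suc k) = - moment_functional (pCons 0 (recip_poly k))"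
  by (simp add: recip_coeff_def)

lemma recip_poly_nonzero [simp]: "recip_poly k \<noteq> 0"
  by (induction k) auto

lemma degree_recip_poly [simp]: "degree (recip_poly k) = k"
  by (induction k) auto

lemma coeff_recip_poly: "i \<le> k \<Longrightarrow> coeff (recip_poly k) i = recip_coeff (k - i)"
proof (induction k arbitrary: i)
  case IH: (Suc k)
  show ?case
  proof (cases i)
    case 0
    then show ?thesis by (simp only: recip_coeff_def diff_zero)
  next
    case (Suc j)
    then show ?thesis
      using IH.IH[of j] IH.prems by (simp only: recip_poly_Suc coeff_pCons_Suc diff_Suc_Suc Suc_le_mono)
  qed
qed (simp add: recip_coeff_def)

lemma moment_functional_recip_poly_Suc: "moment_functional (recip_poly (Suc k)) = 0"
  unfolding recip_poly_Suc recip_coeff_Suc by (subst moment_functional_pCons) (rule left_minus)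

text \<open>
  The \<open>k\<close>-th coefficient of the product is \<open>L(recip_poly k)\<close>, which is zero for \<open>k > 0\<close> because of the projection.
\<close>

lemma recip_coeff_inverse: "Abs_fps recip_coeff * Abs_fps arcsin_moment = 1"
proof (rule fps_ext)
  fix k
  have "fps_nth (Abs_fps recip_coeff * Abs_fps arcsin_moment) k
      = fps_nth (Abs_fps arcsin_moment * Abs_fps recip_coeff) k"
    by (simp add: mult.commute)
  also have "\<dots> = (\<Sum>i\<le>k. arcsin_moment i * recip_coeff (k - i))"
    by (simp add: fps_mult_nth atMost_atLeast0)
  also have "\<dots> = moment_functional (recip_poly k)"
    by (simp add: moment_functional_altdef[where n = k] coeff_recip_poly mult.commute)
  also have "\<dots> = fps_nth 1 k"
  proof (cases k)
    case 0
    then show ?thesis using moment_functional_monom[of 0] by (simp add: monom_0 one_pCons)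
  next
    case (Suc j)
    then show ?thesis by (simp only: moment_functional_recip_poly_Suc) simp
  qed
  finally show "fps_nth (Abs_fps recip_coeff * Abs_fps arcsin_moment) k = fps_nth 1 k" .
qed

lemma moment_functional_recip_step:
  "moment_functional (recip_poly (Suc i) * recip_poly (Suc j))
    = moment_functional (pCons 0 (recip_poly i * recip_poly (Suc j)))"
  unfolding recip_poly_Suc[of i] mult_pCons_left
  by (simp only: moment_functional_add moment_functional_smult moment_functional_recip_poly_Suc
      mult_zero_right add_0_left)

text \<open>
  For the bilinear form \<open>L(p q)\<close>, the step from \<open>recip_poly k\<close> to its successor is the compression of
  multiplication by \<open>X\<close> to the orthogonal complement of the constants. It is self-adjoint there,
  so the product depends on \<open>i + j\<close> only.
\<close>

lemma moment_functional_recip_product: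
  "moment_functional (recip_poly (Suc i) * recip_poly (Suc j)) = - recip_coeff (i + j + 2)"
proof (induction i arbitrary: j)
  case 0
  have "moment_functional (recip_poly (Suc 0) * recip_poly (Suc j))
      = moment_functional (pCons 0 (recip_poly (Suc j)))"
    by (simp only: moment_functional_recip_step recip_poly.simps(1) mult_1_left)
  then show ?case
    using recip_coeff_Suc[of "Suc j"] by simp
next
  case (Suc i)
  have "moment_functional (recip_poly (Suc (Suc i)) * recip_poly (Suc j))
      = moment_functional (pCons 0 (recip_poly (Suc i) * recip_poly (Suc j)))"
    by (rule moment_functional_recip_step)
  also have "\<dots> = moment_functional (recip_poly (Suc (Suc j)) * recip_poly (Suc i))"
    unfolding moment_functional_recip_step[of "Suc j" i] by (simp only: mult.commute)
  also have "\<dots> = - recip_coeff (i + Suc j + 2)"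
    unfolding Suc[symmetric] by (simp only: mult.commute)
  finally show ?case
    by simp
qed

text \<open>
  Depending on the parity of \<open>s\<close>, the entries are \<open>-L(w\<^sub>i w\<^sub>j)\<close> or \<open>-L(X w\<^sub>i w\<^sub>j)\<close> for shifted members \<open>w\<^sub>i\<close> of
  the family \<open>recip_poly\<close>. The bound on \<open>s\<close> keeps the constant \<open>recip_poly 0\<close> out of the family: it is
  the only member that is not orthogonal to the constants.
\<close>

lemma hankel_recip_coeff_definite:
  assumes "s \<ge> 2" and zero: "(\<Sum>i<n. \<Sum>j<n. x i * x j * recip_coeff (s + i + j)) = 0"
  shows "\<forall>i<n. x i = 0"
proof -
  define r where "r = (s - 2) div 2"
  define \<epsilon> where "\<epsilon> = (s - 2) mod 2"
  have s: "s = 2 * r + \<epsilon> + 2"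
    using \<open>s \<ge> 2\<close> by (simp add: r_def \<epsilon>_def)
  have "\<epsilon> = 0 \<or> \<epsilon> = 1"
    by (auto simp: \<epsilon>_def)
  then have gram: "moment_functional (monom 1 \<epsilon> * recip_poly (Suc (i + r)) * recip_poly (Suc (j + r)))
      = - recip_coeff (s + i + j)" for i j
  proof
    assume "\<epsilon> = 0"
    then have "s + i + j = i + r + (j + r) + 2"
      using s by simp
    then show ?thesis
      using moment_functional_recip_product[of "i + r" "j + r"] \<open>\<epsilon> = 0\<close>
      by (simp only: monom_0 flip: one_pCons) (simp only: mult_1_left)
  next
    assume "\<epsilon> = 1"
    then have index: "s + i + j = Suc (i + r) + (j + r) + 2"
      using s by simp
    have "monom 1 \<epsilon> * recip_poly (Suc (i + r)) * recip_poly (Suc (j + r)) =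
        pCons 0 (recip_poly (Suc (i + r)) * recip_poly (Suc (j + r)))"
      unfolding \<open>\<epsilon> = 1\<close> by (simp add: monom_Suc monom_0 mult_pCons_left del: recip_poly.simps(2))
    then show ?thesis
      unfolding index moment_functional_recip_product[symmetric] by (simp only: moment_functional_recip_step)
  qed
  show ?thesis
  proof (rule moment_functional_gram_definite[where u = "\<lambda>i. recip_poly (Suc (i + r))" and r = "Suc r" and s = \<epsilon>])
    show "(\<Sum>i<n. \<Sum>j<n. x i * x j *
        moment_functional (monom 1 \<epsilon> * recip_poly (Suc (i + r)) * recip_poly (Suc (j + r)))) = 0"
      unfolding gram using zero by (simp add: sum_negf)
    show "degree (recip_poly (Suc (i + r))) = i + Suc r" for i
      by (simp only: degree_recip_poly add_Suc_right)
  qed (rule recip_poly_nonzero)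
qed

section \<open>Normality of the Pade table\<close>

text \<open>
  Reversing the coefficients of \<open>q\<close> turns the vanishing of \<open>b\<close> consecutive coefficients of \<open>c * q\<close>
  into a homogeneous system with the Hankel matrix \<open>c (s + i + j)\<close>.
\<close>

lemma hankel_kernel_trivial:
  fixes c :: "nat \<Rightarrow> 'a::comm_ring_1" and q :: "'a poly"
  assumes definite: "\<And>x. (\<Sum>i<b. \<Sum>j<b. x i * x j * c (s + i + j)) = 0 \<Longrightarrow> \<forall>i<b. x i = 0"
    and shift: "a + 1 = b + s"
    and deg: "\<And>i. i \<ge> b \<Longrightarrow> coeff q i = 0"
    and vanish: "\<And>k. a \<le> k \<Longrightarrow> k < a + b \<Longrightarrow> fps_nth (Abs_fps c * fps_of_poly q) k = 0"
  shows "q = 0"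
proof -
  define x where "x = (\<lambda>i. coeff q (b - 1 - i))"
  have row: "(\<Sum>i<b. x i * c (s + i + j)) = 0" if "j < b" for j
  proof -
    have "0 = fps_nth (fps_of_poly q * Abs_fps c) (a + j)"
      using vanish[of "a + j"] that by (simp add: mult.commute)
    also have "\<dots> = (\<Sum>i=0..a + j. coeff q i * c (a + j - i))"
      by (simp add: fps_mult_nth)
    also have "\<dots> = (\<Sum>i<b. coeff q i * c (a + j - i))"
      by (rule sum.mono_neutral_right) (use that shift deg in auto)
    also have "\<dots> = (\<Sum>i<b. coeff q (b - Suc i) * c (a + j - (b - Suc i)))"
      by (rule sum.nat_diff_reindex[symmetric])
    also have "\<dots> = (\<Sum>i<b. x i * c (s + i + j))"
    proof (rule sum.cong)
      fix i assume "i \<in> {..<b}"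
      then have "a + j - (b - Suc i) = s + i + j"
        using shift by auto
      then show "coeff q (b - Suc i) * c (a + j - (b - Suc i)) = x i * c (s + i + j)"
        by (simp add: x_def)
    qed simp
    finally show ?thesis by simp
  qed
  have "(\<Sum>i<b. \<Sum>j<b. x i * x j * c (s + i + j)) = (\<Sum>j<b. x j * (\<Sum>i<b. x i * c (s + i + j)))"
    by (subst sum.swap) (simp add: sum_distrib_left mult_ac)
  also have "\<dots> = 0"
    by (simp add: row)
  finally have x0: "\<forall>i<b. x i = 0"
    by (rule definite)
  have "coeff q i = 0" for i
  proof (cases "i < b")
    case True
    then show ?thesis using x0[rule_format, of "b - 1 - i"] by (simp add: x_def)
  qed (use deg in auto)
  then show ?thesis by (simp add: poly_eq_iff)
qed

text \<open>
  If \<open>b \<le> a\<close>, the coefficients \<open>a, ..., a + b - 1\<close> of the product with \<open>q\<close> vanish, and the Hankel matrices of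
  the series apply to \<open>q\<close>. Otherwise multiplication by the reciprocal series exchanges the roles of \<open>p\<close>
  and \<open>q\<close>; the Hankel shift \<open>b + 1 - a\<close> is then at least 2.
\<close>

lemma pade_table_normal:
  fixes p q :: "real poly"
  assumes p: "\<And>i. i \<ge> a \<Longrightarrow> coeff p i = 0" and q: "\<And>i. i \<ge> b \<Longrightarrow> coeff q i = 0"
    and match: "\<And>k. k < a + b \<Longrightarrow> coeff p k = fps_nth (Abs_fps arcsin_moment * fps_of_poly q) k"
  shows "p = 0 \<and> q = 0"
proof (cases "b \<le> a")
  case True
  have "q = 0"
  proof (rule hankel_kernel_trivial[where c = arcsin_moment and s = "a + 1 - b" and a = a and b = b])
    show "\<And>x. (\<Sum>i<b. \<Sum>j<b. x i * x j * arcsin_moment (a + 1 - b + i + j)) = 0 \<Longrightarrow> \<forall>i<b. x i = 0"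
      by (rule hankel_arcsin_moment_definite)
    show "fps_nth (Abs_fps arcsin_moment * fps_of_poly q) k = 0" if "a \<le> k" "k < a + b" for k
      using match[OF that(2)] p[OF that(1)] by simp
  qed (use True q in auto)
  moreover have "coeff p i = 0" for i
    using match[of i] p[of i] \<open>q = 0\<close> by (cases "i < a") auto
  ultimately show ?thesis by (simp add: poly_eq_iff)
next
  case False
  define E where "E = Abs_fps recip_coeff"
  have *: "fps_nth (E * fps_of_poly p) k = coeff q k" if "k < a + b" for k
  proof -
    have "fps_nth (E * fps_of_poly p) k = fps_nth (E * (Abs_fps arcsin_moment * fps_of_poly q)) k"
      unfolding fps_mult_nth[of E] using that by (intro sum.cong) (auto simp: match)
    also have "E * (Abs_fps arcsin_moment * fps_of_poly q) = fps_of_poly q"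
      using recip_coeff_inverse by (simp add: E_def mult.assoc[symmetric])
    finally show ?thesis by simp
  qed
  have "p = 0"
  proof (rule hankel_kernel_trivial[where c = recip_coeff and s = "b + 1 - a" and a = b and b = a])
    show "\<And>x. (\<Sum>i<a. \<Sum>j<a. x i * x j * recip_coeff (b + 1 - a + i + j)) = 0 \<Longrightarrow> \<forall>i<a. x i = 0"
      by (rule hankel_recip_coeff_definite[where s = "b + 1 - a"]) (use False in auto)
    show "fps_nth (Abs_fps recip_coeff * fps_of_poly p) k = 0" if "b \<le> k" "k < b + a" for k
      using *[of k] q[OF that(1)] that(2) by (simp add: E_def)
  qed (use False p in auto)
  moreover have "coeff q i = 0" for i
    using *[of i] q[of i] \<open>p = 0\<close> by (cases "i < b") auto
  ultimately show ?thesis by (simp add: poly_eq_iff)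
qed

section \<open>The square as a power series in the squared half-angle sine\<close>

text \<open>
  The power series of \<open>4 arcsin^2(sqrt t)\<close>.
\<close>

definition sq_fps :: "real fps" where
  "sq_fps = fps_X * (fps_const 4 * Abs_fps arcsin_moment)"

text \<open>
  The power series of \<open>sin^2(\<xi>/2)\<close>.
\<close>

definition sin_half_sq :: "real fps" where
  "sin_half_sq = fps_const (1 / 2) * (1 - fps_cos 1)"

lemma sin_half_sq_0 [simp]: "fps_nth sin_half_sq 0 = 0"
  by (simp add: sin_half_sq_def)

lemma subdegree_sin_half_sq: "subdegree sin_half_sq = 2"
proof (rule subdegreeI)
  show "fps_nth sin_half_sq 2 \<noteq> 0"
    by (simp add: sin_half_sq_def fps_cos_def)
  show "fps_nth sin_half_sq i = 0" if "i < 2" for i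
    using that by (auto simp: sin_half_sq_def less_2_cases_iff)
qed

lemma sq_fps_ode:
  "fps_X * (1 - fps_X) * fps_deriv (fps_deriv sq_fps) + (fps_const (1 / 2) - fps_X) * fps_deriv sq_fps = fps_const 2"
proof (rule fps_ext)
  fix n
  define A where "A = fps_nth sq_fps"
  have A0: "A 0 = 0" and A_Suc: "A (Suc k) = 4 * arcsin_moment k" for k
    by (simp_all add: A_def sq_fps_def)
  have expand: "fps_X * (1 - fps_X) * fps_deriv (fps_deriv sq_fps) + (fps_const (1 / 2) - fps_X) * fps_deriv sq_fps
      = fps_X * fps_deriv (fps_deriv sq_fps) - fps_X * (fps_X * fps_deriv (fps_deriv sq_fps))
        + fps_const (1 / 2) * fps_deriv sq_fps - fps_X * fps_deriv sq_fps"
    by (simp add: algebra_simps)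
  show "fps_nth (fps_X * (1 - fps_X) * fps_deriv (fps_deriv sq_fps)
      + (fps_const (1 / 2) - fps_X) * fps_deriv sq_fps) n = fps_nth (fps_const 2) n"
  proof (cases n)
    case 0
    then show ?thesis
      unfolding expand by (simp add: A_Suc[unfolded A_def])
  next
    case (Suc m)
    have nth: "fps_nth (fps_X * fps_deriv (fps_deriv sq_fps) - fps_X * (fps_X * fps_deriv (fps_deriv sq_fps))
        + fps_const (1 / 2) * fps_deriv sq_fps - fps_X * fps_deriv sq_fps) (Suc m) =
        (real m + 1) * (real m + 2) * A (Suc (Suc m)) - real m * (real m + 1) * A (Suc m)
        + 1 / 2 * (real m + 2) * A (Suc (Suc m)) - (real m + 1) * A (Suc m)"
      by (cases m) (simp_all add: A_def algebra_simps)
    have "real m + 2 \<noteq> 0" "real m + 3 / 2 \<noteq> 0" by linarith+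
    then have "arcsin_moment (Suc m) * ((real m + 2) * (real m + 3 / 2)) = arcsin_moment m * (real m + 1)\<^sup>2"
      by simp
    moreover have "(t + 1) * (t + 2) * (4 * M) - t * (t + 1) * (4 * N) + 1 / 2 * (t + 2) * (4 * M) - (t + 1) * (4 * N)
        = 4 * (M * ((t + 2) * (t + 3 / 2)) - N * (t + 1)\<^sup>2)" for t M N :: real
      by (simp add: algebra_simps power2_eq_square)
    ultimately show ?thesis
      unfolding expand unfolding Suc nth unfolding A_Suc
      by (simp del: arcsin_moment.simps)
  qed
qed

text \<open>
  Since \<open>Y = sin^2(\<xi>/2)\<close> satisfies \<open>Y'^2 = Y (1 - Y)\<close> and \<open>Y'' = 1/2 - Y\<close>, the differential equation
  \<open>sq_fps_ode\<close> says that the composition has constant second derivative 2.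
\<close>

lemma sq_fps_compose: "sq_fps oo sin_half_sq = fps_X\<^sup>2"
proof -
  have D1: "fps_deriv sin_half_sq = fps_const (1 / 2) * fps_sin 1"
    by (simp add: sin_half_sq_def fps_cos_deriv flip: fps_const_neg)
  have cos: "fps_cos 1 = 1 - fps_const 2 * sin_half_sq"
    by (simp add: sin_half_sq_def mult.assoc[symmetric])
  have D2: "fps_deriv (fps_deriv sin_half_sq) = fps_const (1 / 2) - sin_half_sq"
    unfolding D1 by (simp add: fps_sin_deriv cos algebra_simps)
  have "(fps_sin 1)\<^sup>2 = 1 - (1 - fps_const 2 * sin_half_sq)\<^sup>2"
    using fps_sin_cos_sum_of_squares[of "1::real"] unfolding cos by (simp add: algebra_simps)
  also have "\<dots> = fps_const 4 * (sin_half_sq * (1 - sin_half_sq))"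
    by (simp add: power2_eq_square algebra_simps flip: numeral_fps_const)
  finally have sin_sq: "(fps_deriv sin_half_sq)\<^sup>2 = sin_half_sq * (1 - sin_half_sq)"
    unfolding D1 by (simp add: power_mult_distrib fps_const_power mult.assoc[symmetric] power_divide)
  define G where "G = sq_fps oo sin_half_sq"
  have G1: "fps_deriv G = (fps_deriv sq_fps oo sin_half_sq) * fps_deriv sin_half_sq"
    by (simp add: G_def fps_compose_deriv)
  have "fps_deriv (fps_deriv G) = (fps_deriv (fps_deriv sq_fps) oo sin_half_sq) * (fps_deriv sin_half_sq)\<^sup>2
      + (fps_deriv sq_fps oo sin_half_sq) * fps_deriv (fps_deriv sin_half_sq)"
    by (simp add: G1 fps_compose_deriv power2_eq_square algebra_simps)
  also have "\<dots> = (fps_X * (1 - fps_X) * fps_deriv (fps_deriv sq_fps)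
      + (fps_const (1 / 2) - fps_X) * fps_deriv sq_fps) oo sin_half_sq"
    unfolding sin_sq D2
    by (simp add: fps_compose_add_distrib fps_compose_sub_distrib fps_compose_mult_distrib algebra_simps)
  also have "\<dots> = fps_const 2"
    by (simp add: sq_fps_ode)
  also have "\<dots> = fps_deriv (fps_deriv (fps_X\<^sup>2))"
    by (simp add: fps_deriv_power numeral_fps_const)
  finally have "fps_deriv G = fps_const (fps_nth (fps_deriv G) 0 - fps_nth (fps_deriv (fps_X\<^sup>2)) 0) + fps_deriv (fps_X\<^sup>2)"
    by (rule iffD1[OF fps_deriv_eq_iff])
  moreover have "fps_nth (fps_deriv G) 0 - fps_nth (fps_deriv (fps_X\<^sup>2)) 0 = 0"
    by (simp add: G1 D1 fps_X_power_iff)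
  ultimately have "fps_deriv G = fps_deriv (fps_X\<^sup>2)"
    by simp
  then have "G = fps_const (fps_nth G 0 - fps_nth (fps_X\<^sup>2) 0) + fps_X\<^sup>2"
    by (rule iffD1[OF fps_deriv_eq_iff])
  moreover have "fps_nth G 0 - fps_nth (fps_X\<^sup>2) 0 = 0"
    by (simp add: G_def sq_fps_def)
  ultimately show ?thesis
    unfolding G_def by simp
qed

text \<open>
  The Chebyshev polynomials of the first kind at \<open>1 - 2t\<close>, that is, \<open>cos(n\<xi>)\<close> as a polynomial in
  \<open>t = sin^2(\<xi>/2)\<close>.
\<close>

fun cos_poly :: "nat \<Rightarrow> real poly" where
  "cos_poly 0 = 1"
| "cos_poly (Suc 0) = [:1, -2:]"
| "cos_poly (Suc (Suc n)) = [:2, -4:] * cos_poly (Suc n) - cos_poly n"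

lemma degree_cos_poly: "degree (cos_poly n) = n \<and> cos_poly n \<noteq> 0"
proof (induction n rule: cos_poly.induct)
  case (3 n)
  have deg: "degree ([:2, -4:] * cos_poly (Suc n)) = Suc (Suc n)"
    using 3 by (subst degree_mult_eq) auto
  then have "degree ([:2, -4:] * cos_poly (Suc n) + - cos_poly n) = Suc (Suc n)"
    using 3 by (subst degree_add_eq_left) auto
  then have "degree (cos_poly (Suc (Suc n))) = Suc (Suc n)"
    by simp
  then show ?case
    by (metis degree_0 nat.distinct(1))
qed auto

lemma poly_cos_poly_0: "poly (cos_poly n) 0 = 1"
  by (induction n rule: cos_poly.induct) auto

lemma cos_poly_compose: "fps_of_poly (cos_poly n) oo sin_half_sq = fps_cos (real n)"
proof (induction n rule: cos_poly.induct)
  case 2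
  have base: "fps_of_poly [:1, -2:] = 1 - fps_const 2 * (fps_X :: real fps)"
    by (simp add: fps_of_poly_pCons fps_const_neg[symmetric] del: fps_const_neg)
  show ?case
    unfolding cos_poly.simps base
    by (simp add: fps_compose_sub_distrib fps_compose_mult_distrib)
      (simp add: sin_half_sq_def mult.assoc[symmetric])
next
  case (3 n)
  have "fps_of_poly [:2, -4:] = fps_const 2 * (1 - fps_const 2 * (fps_X :: real fps))"
    by (simp add: fps_of_poly_pCons fps_const_neg[symmetric] algebra_simps mult.assoc[symmetric] del: fps_const_neg)
  from arg_cong[OF this, of "\<lambda>f. f oo sin_half_sq"]
  have base: "fps_of_poly [:2, -4:] oo sin_half_sq = fps_const 2 * fps_cos 1"
    unfolding fps_compose_mult_distrib[OF sin_half_sq_0] fps_compose_sub_distrib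
    by (simp add: sin_half_sq_def mult.assoc[symmetric])
  have "fps_cos (real (Suc (Suc n))) + fps_cos (real n) = fps_const 2 * fps_cos 1 * fps_cos (real (Suc n))"
    using fps_cos_add[of "real (Suc n)" 1] fps_cos_add[of "real (Suc n)" "-1"]
    by (simp add: fps_cos_odd fps_sin_even algebra_simps flip: numeral_fps_const)
  then show ?case
    unfolding cos_poly.simps fps_of_poly_mult fps_of_poly_diff fps_compose_sub_distrib
      fps_compose_mult_distrib[OF sin_half_sq_0] base 3 by (simp only: diff_eq_eq)
qed simp

section \<open>Rigidity of the even moment equations\<close>

text \<open>
  The moment of index \<open>2k\<close> of a symmetric formula after \<open>j\<close> and \<open>-j\<close> have been merged: \<open>x\<close> and \<open>y\<close> weight the
  nonnegative nodes below \<open>a\<close> and \<open>b\<close>. It is generic in the field because it is used for rational, real and complex weights.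
\<close>

definition even_moment :: "nat \<Rightarrow> nat \<Rightarrow> (nat \<Rightarrow> 'a) \<Rightarrow> (nat \<Rightarrow> 'a) \<Rightarrow> nat \<Rightarrow> 'a::field_char_0" where
  "even_moment a b x y k = (\<Sum>j<a. x j * of_nat (j ^ (2 * k)) / of_nat (fact (2 * k)))
    + (if k = 0 then 0 else \<Sum>j<b. y j * of_nat (j ^ (2 * k - 2)) / of_nat (fact (2 * k - 2)))"

definition symbol_poly :: "nat \<Rightarrow> (nat \<Rightarrow> real) \<Rightarrow> real poly" where
  "symbol_poly n x = (\<Sum>j<n. smult (x j) (cos_poly j))"

lemma coeff_symbol_poly_eq_0: "n \<le> i \<Longrightarrow> coeff (symbol_poly n x) i = 0"
  unfolding symbol_poly_def coeff_sum
  by (intro sum.neutral) (auto simp: coeff_eq_0 degree_cos_poly)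

lemma symbol_poly_eq_0D: "symbol_poly n x = 0 \<Longrightarrow> \<forall>j<n. x j = 0"
  by (rule graded_family_independent[where u = cos_poly and r = 0])
    (auto simp: symbol_poly_def degree_cos_poly)

lemma coeff_0_symbol_poly: "coeff (symbol_poly n x) 0 = (\<Sum>j<n. x j)"
  by (simp add: symbol_poly_def poly_sum poly_cos_poly_0 flip: poly_0_coeff_0)

lemma symbol_poly_compose:
  "fps_of_poly (symbol_poly n x) oo sin_half_sq = (\<Sum>j<n. fps_const (x j) * fps_cos (real j))"
  by (simp add: symbol_poly_def fps_of_poly_sum fps_of_poly_smult fps_compose_sum_distrib
      fps_compose_mult_distrib cos_poly_compose)

text \<open>
  Up to the sign \<open>(-1)^k\<close>, the even moments are the coefficients of
  \<open>\<Sum>\<^sub>j x\<^sub>j cos(j\<xi>) - \<xi>^2 \<Sum>\<^sub>j y\<^sub>j cos(j\<xi>)\<close>, which is the composition of \<open>P - F Q\<close> with \<open>sin^2(\<xi>/2)\<close>. As the inner series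
  has order 2, vanishing of the composition to order \<open>2K\<close> is vanishing of \<open>P - F Q\<close> to order \<open>K\<close>.
\<close>

lemma even_moment_pade:
  assumes "\<And>k. k < K \<Longrightarrow> even_moment a b x y k = (0::real)" and "k < K"
  shows "coeff (symbol_poly a x) k = fps_nth (sq_fps * fps_of_poly (symbol_poly b y)) k"
proof -
  define E where "E = fps_of_poly (symbol_poly a x) - sq_fps * fps_of_poly (symbol_poly b y)"
  have comp: "E oo sin_half_sq = (\<Sum>j<a. fps_const (x j) * fps_cos (real j))
      - fps_X\<^sup>2 * (\<Sum>j<b. fps_const (y j) * fps_cos (real j))"
    by (simp add: E_def fps_compose_sub_distrib fps_compose_mult_distrib symbol_poly_compose sq_fps_compose)
  have vanish: "fps_nth (E oo sin_half_sq) n = 0" if "n < 2 * K" for n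
  proof (cases "even n")
    case True
    then obtain k where n: "n = 2 * k" by blast
    have "fps_nth (E oo sin_half_sq) n = (-1) ^ k * even_moment a b x y k"
    proof (cases k)
      case 0
      then show ?thesis
        by (simp add: comp n fps_sum_nth fps_X_power_mult_nth even_moment_def)
    next
      case (Suc i)
      then have "fps_nth (E oo sin_half_sq) n =
          (\<Sum>j<a. x j * ((-1) ^ k * real j ^ (2 * k) / fact (2 * k)))
          - (\<Sum>j<b. y j * ((-1) ^ i * real j ^ (2 * i) / fact (2 * i)))"
        by (simp add: comp n fps_sum_nth fps_X_power_mult_nth fps_cos_def del: fact_Suc)
      also have "\<dots> = (-1) ^ k * even_moment a b x y k"
        using Suc by (simp add: even_moment_def distrib_left sum_distrib_left mult_ac sum_negf del: fact_Suc)
      finally show ?thesis .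
    qed
    then show ?thesis
      using assms(1)[of k] that n by simp
  next
    case False
    then show ?thesis
      by (auto simp: comp fps_sum_nth fps_X_power_mult_nth fps_cos_def)
  qed
  have "fps_nth E k = 0"
  proof (rule ccontr)
    assume "fps_nth E k \<noteq> 0"
    then have "E \<noteq> 0" and "subdegree E \<le> k"
      by (auto intro: subdegree_leI)
    moreover have deg: "subdegree (E oo sin_half_sq) = subdegree E * 2"
      unfolding subdegree_fps_compose[OF sin_half_sq_0] subdegree_sin_half_sq by (rule refl)
    ultimately have "subdegree (E oo sin_half_sq) < 2 * K"
      using \<open>k < K\<close> by linarith
    then have "fps_nth (E oo sin_half_sq) (subdegree (E oo sin_half_sq)) = 0"
      by (rule vanish)
    moreover have "E oo sin_half_sq \<noteq> 0"
      using \<open>E \<noteq> 0\<close> subdegree_sin_half_sq by (auto simp: fps_compose_eq_0_iff)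
    ultimately show False
      using nth_subdegree_zero_iff by blast
  qed
  then show ?thesis
    by (simp add: E_def)
qed

text \<open>
  The constant term of \<open>F\<close> is zero, hence so is that of \<open>p\<close>. Dividing by the variable leads to the Pade table of \<open>F(t)/t\<close>.
\<close>

lemma pade_sq_trivial:
  assumes "a \<ge> 1" and p: "\<And>i. i \<ge> a \<Longrightarrow> coeff p i = 0" and q: "\<And>i. i \<ge> b \<Longrightarrow> coeff q i = 0"
    and match: "\<And>k. k < a + b \<Longrightarrow> coeff p k = fps_nth (sq_fps * fps_of_poly q) k"
  shows "p = 0 \<and> q = 0"
proof -
  obtain c p' where p': "p = pCons c p'" by (cases p)
  have "c = 0"
    using match[of 0] \<open>a \<ge> 1\<close> by (simp add: p' sq_fps_def)
  have "p' = 0 \<and> smult 4 q = 0"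
  proof (rule pade_table_normal[where a = "a - 1" and b = b])
    show "coeff p' i = 0" if "i \<ge> a - 1" for i
      using p[of "Suc i"] that by (simp add: p')
    show "coeff p' k = fps_nth (Abs_fps arcsin_moment * fps_of_poly (smult 4 q)) k" if "k < a - 1 + b" for k
    proof -
      have "sq_fps * fps_of_poly q = fps_X * (Abs_fps arcsin_moment * fps_of_poly (smult 4 q))"
        by (simp add: sq_fps_def fps_of_poly_smult mult_ac)
      then have "fps_nth (sq_fps * fps_of_poly q) (Suc k) = fps_nth (Abs_fps arcsin_moment * fps_of_poly (smult 4 q)) k"
        by simp
      moreover have "Suc k < a + b"
        using that \<open>a \<ge> 1\<close> by linarith
      ultimately show ?thesis
        using match[of "Suc k"] by (simp only: p' coeff_pCons_Suc)
    qed
  qed (use q in auto)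
  then show ?thesis
    using \<open>c = 0\<close> by (simp add: p')
qed

theorem even_moments_determine:
  fixes x y :: "nat \<Rightarrow> real"
  assumes "a \<ge> 1" and "\<And>k. k < a + b \<Longrightarrow> even_moment a b x y k = 0"
  shows "(\<forall>j<a. x j = 0) \<and> (\<forall>j<b. y j = 0)"
  using pade_sq_trivial[of a "symbol_poly a x" b "symbol_poly b y"] assms even_moment_pade[of "a + b" a b x y]
    coeff_symbol_poly_eq_0 symbol_poly_eq_0D by blast

text \<open>
  The sum of the \<open>y\<^sub>j\<close> is \<open>Q(0)\<close>. If it is zero, then so is \<open>P(0)\<close>, and dividing both polynomials by the variable
  lowers both degree bounds by one and the order of contact only by one.
\<close>

theorem even_moments_sum_determine:
  fixes x y :: "nat \<Rightarrow> real"
  assumes "a \<ge> 2" "b \<ge> 1" and moments: "\<And>k. k < a + b - 1 \<Longrightarrow> even_moment a b x y k = 0"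
    and "(\<Sum>j<b. y j) = 0"
  shows "(\<forall>j<a. x j = 0) \<and> (\<forall>j<b. y j = 0)"
proof -
  obtain c p where p: "symbol_poly a x = pCons c p" by (cases "symbol_poly a x")
  obtain d q where q: "symbol_poly b y = pCons d q" by (cases "symbol_poly b y")
  have match: "coeff (pCons c p) k = fps_nth (sq_fps * fps_of_poly (pCons d q)) k" if "k < a + b - 1" for k
    using even_moment_pade[OF moments that] by (simp only: p q)
  have "d = 0"
    using coeff_0_symbol_poly[of b y] assms(4) by (simp add: q)
  have "c = 0"
    using match[of 0] assms(1,2) by (simp add: sq_fps_def)
  have "p = 0 \<and> q = 0"
  proof (rule pade_sq_trivial[where a = "a - 1" and b = "b - 1"])
    show "coeff p i = 0" if "i \<ge> a - 1" for i
      using coeff_symbol_poly_eq_0[of a "Suc i" x] that by (simp add: p)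
    show "coeff q i = 0" if "i \<ge> b - 1" for i
      using coeff_symbol_poly_eq_0[of b "Suc i" y] that by (simp add: q)
    show "coeff p k = fps_nth (sq_fps * fps_of_poly q) k" if "k < a - 1 + (b - 1)" for k
    proof -
      have "sq_fps * fps_of_poly (pCons d q) = fps_X * (sq_fps * fps_of_poly q)"
        by (simp add: \<open>d = 0\<close> fps_of_poly_pCons mult_ac)
      then have "fps_nth (sq_fps * fps_of_poly (pCons d q)) (Suc k) = fps_nth (sq_fps * fps_of_poly q) k"
        by (simp only: fps_X_mult_nth) simp
      moreover have "Suc k < a + b - 1"
        using that assms(1,2) by linarith
      ultimately show ?thesis
        using match[of "Suc k"] by (simp only: coeff_pCons_Suc)
    qed
  qed (use assms in auto)
  then show ?thesis
    using symbol_poly_eq_0D p q \<open>c = 0\<close> \<open>d = 0\<close> by simp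
qed

section \<open>Consistency in terms of moments\<close>

lemma nth_deriv_0 [simp]: "nth_deriv 0 u = u"
  by (simp add: nth_deriv_def)

lemma nth_deriv_Suc: "nth_deriv (Suc k) u = (\<lambda>x. vector_derivative (nth_deriv k u) (at x))"
  by (simp add: nth_deriv_def)

lemma nth_deriv_add: "nth_deriv k (nth_deriv i u) = nth_deriv (k + i) u"
  by (simp add: nth_deriv_def funpow_add)

lemma smooth_nth_deriv: "smooth u \<Longrightarrow> smooth (nth_deriv i u)"
  by (simp add: smooth_def nth_deriv_add)

lemma smooth_has_vector_derivative:
  "smooth u \<Longrightarrow> (nth_deriv k u has_vector_derivative nth_deriv (Suc k) u x) (at x)"
  by (simp add: smooth_def nth_deriv_Suc vector_derivative_works)

lemma monomial_derivative:
  "((\<lambda>x. complex_of_real (c * x ^ i)) has_vector_derivative complex_of_real (c * real i * t ^ (i - 1))) (at t)"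
proof (rule has_vector_derivative_of_real)
  show "((\<lambda>x. c * x ^ i) has_field_derivative c * real i * t ^ (i - 1)) (at t)"
    by (auto intro!: derivative_eq_intros)
qed

lemma nth_deriv_monomial:
  "nth_deriv i (\<lambda>x. complex_of_real (x ^ k)) = (\<lambda>x. complex_of_real ((\<Prod>j<i. real (k - j)) * x ^ (k - i)))"
proof (induction i)
  case (Suc i)
  show ?case
    unfolding nth_deriv_Suc Suc
    by (rule ext, rule vector_derivative_at)
      (use monomial_derivative[of "\<Prod>j<i. real (k - j)" "k - i"] in simp)
qed simp

lemma smooth_monomial: "smooth (\<lambda>x. complex_of_real (x ^ k))"
  unfolding smooth_def nth_deriv_monomial
  using monomial_derivative by (auto intro: differentiableI_vector)

lemma taylor_bound_real:
  fixes f :: "nat \<Rightarrow> real \<Rightarrow> real"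
  assumes "\<And>k x. (f k has_real_derivative f (Suc k) x) (at x)"
  obtains C where "\<And>x. \<bar>x\<bar> \<le> 1 \<Longrightarrow> \<bar>f 0 x - (\<Sum>k<K. f k 0 / fact k * x ^ k)\<bar> \<le> C * \<bar>x\<bar> ^ K"
proof -
  have "continuous_on {-1..1} (f K)"
    using assms by (intro continuous_at_imp_continuous_on ballI DERIV_isCont) blast
  then have "bounded (f K ` {-1..1})"
    by (intro compact_imp_bounded compact_continuous_image) auto
  then obtain C where "\<forall>y\<in>f K ` {-1..1}. norm y \<le> C"
    unfolding bounded_iff by blast
  then have C: "\<bar>f K t\<bar> \<le> C" if "t \<in> {-1..1}" for t
    using that by simp
  show thesis
  proof (rule that[of "C / fact K"])
    fix x :: real assume x: "\<bar>x\<bar> \<le> 1"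
    obtain t where t: "\<bar>t\<bar> \<le> \<bar>x\<bar>"
        "f 0 x = (\<Sum>k<K. f k 0 / fact k * x ^ k) + f K t / fact K * x ^ K"
      using Maclaurin_all_le[of f "f 0" x K] assms by auto
    have "\<bar>t\<bar> \<le> 1"
      using t(1) x by linarith
    then have "\<bar>f K t\<bar> \<le> C"
      by (intro C) (simp add: abs_le_iff)
    have "\<bar>f 0 x - (\<Sum>k<K. f k 0 / fact k * x ^ k)\<bar> = \<bar>f K t\<bar> / fact K * \<bar>x\<bar> ^ K"
      using t(2) by (simp add: abs_mult power_abs)
    also have "\<dots> \<le> C / fact K * \<bar>x\<bar> ^ K"
      using \<open>\<bar>f K t\<bar> \<le> C\<close> by (intro mult_right_mono divide_right_mono) auto
    finally show "\<bar>f 0 x - (\<Sum>k<K. f k 0 / fact k * x ^ k)\<bar> \<le> C / fact K * \<bar>x\<bar> ^ K" .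
  qed
qed

text \<open>
  The Lagrange form of the remainder is only valid for real functions, so it is applied to the real and the imaginary part.
\<close>

lemma smooth_taylor_bound:
  assumes "smooth u"
  obtains C where
    "\<And>x. \<bar>x\<bar> \<le> 1 \<Longrightarrow> norm (u x - (\<Sum>k<K. nth_deriv k u 0 * of_real (x ^ k) / fact k)) \<le> C * \<bar>x\<bar> ^ K"
proof -
  have Re: "((\<lambda>x. Re (nth_deriv k u x)) has_real_derivative Re (nth_deriv (Suc k) u x)) (at x)"
    and Im: "((\<lambda>x. Im (nth_deriv k u x)) has_real_derivative Im (nth_deriv (Suc k) u x)) (at x)" for k x
    using smooth_has_vector_derivative[OF assms, of k x] by (auto simp: has_vector_derivative_complex_iff)
  obtain C1 where C1: "\<And>x. \<bar>x\<bar> \<le> 1 \<Longrightarrow>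
      \<bar>Re (nth_deriv 0 u x) - (\<Sum>k<K. Re (nth_deriv k u 0) / fact k * x ^ k)\<bar> \<le> C1 * \<bar>x\<bar> ^ K"
    by (rule taylor_bound_real[of "\<lambda>k x. Re (nth_deriv k u x)" K, OF Re]) blast
  obtain C2 where C2: "\<And>x. \<bar>x\<bar> \<le> 1 \<Longrightarrow>
      \<bar>Im (nth_deriv 0 u x) - (\<Sum>k<K. Im (nth_deriv k u 0) / fact k * x ^ k)\<bar> \<le> C2 * \<bar>x\<bar> ^ K"
    by (rule taylor_bound_real[of "\<lambda>k x. Im (nth_deriv k u x)" K, OF Im]) blast
  show thesis
  proof (rule that[of "C1 + C2"])
    fix x :: real assume x: "\<bar>x\<bar> \<le> 1"
    define z where "z = u x - (\<Sum>k<K. nth_deriv k u 0 * of_real (x ^ k) / fact k)"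
    \<comment> \<open>writing a summand as a real multiple lets the simplifier take its real and imaginary parts\<close>
    have summand: "nth_deriv k u 0 * of_real (x ^ k) / fact k = of_real (x ^ k / fact k) * nth_deriv k u 0" for k
      by simp
    have "Re z = Re (nth_deriv 0 u x) - (\<Sum>k<K. Re (nth_deriv k u 0) / fact k * x ^ k)"
      and "Im z = Im (nth_deriv 0 u x) - (\<Sum>k<K. Im (nth_deriv k u 0) / fact k * x ^ k)"
      unfolding z_def summand by (simp_all del: of_real_divide of_real_power add: Re_sum Im_sum mult_ac)
    then have "norm z \<le> C1 * \<bar>x\<bar> ^ K + C2 * \<bar>x\<bar> ^ K"
      using C1[OF x] C2[OF x] cmod_le[of z] by linarith
    then show "norm (u x - (\<Sum>k<K. nth_deriv k u 0 * of_real (x ^ k) / fact k)) \<le> (C1 + C2) * \<bar>x\<bar> ^ K"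
      by (simp add: z_def distrib_right)
  qed
qed

definition formula_moment :: "nat \<Rightarrow> (int \<Rightarrow> complex) \<Rightarrow> (int \<Rightarrow> complex) \<Rightarrow> nat \<Rightarrow> complex" where
  "formula_moment N d s k = (\<Sum>j\<in>{-int N..int N}. d j * of_int j ^ k / fact k)
    + (if k < 2 then 0 else \<Sum>j\<in>{-int N..int N}. s j * of_int j ^ (k - 2) / fact (k - 2))"

lemma infsum_finite_support:
  fixes f :: "int \<Rightarrow> complex"
  assumes "\<And>j. \<bar>j\<bar> > int N \<Longrightarrow> f j = 0"
  shows "(\<Sum>\<^sub>\<infinity>j. f j) = (\<Sum>j\<in>{-int N..int N}. f j)"
proof -
  have "(\<Sum>\<^sub>\<infinity>j. f j) = infsum f {-int N..int N}"
    by (rule infsum_cong_neutral) (use assms in auto)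
  then show ?thesis by simp
qed

text \<open>
  The test function \<open>x^k\<close> isolates the moment of index \<open>k\<close>: the sum in the definition of consistency
  equals \<open>h^k k!\<close> times that moment, which is \<open>O(h^(n+2))\<close> for \<open>k < n + 2\<close> only if the moment is zero.
\<close>

lemma consistent_imp_formula_moment:
  assumes d: "\<And>j. \<bar>j\<bar> > int N \<Longrightarrow> d j = 0" and s: "\<And>j. \<bar>j\<bar> > int N \<Longrightarrow> s j = 0"
    and "consistent n d s" and k: "k < n + 2"
  shows "formula_moment N d s k = 0"
proof -
  define M where "M = fact k * formula_moment N d s k"
  let ?u = "\<lambda>x. complex_of_real (x ^ k)"
  have defect: "(\<Sum>\<^sub>\<infinity>j. d j * ?u (of_int j * h) + of_real (h ^ 2) * s j * nth_deriv 2 ?u (of_int j * h))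
      = of_real (h ^ k) * M" for h
  proof -
    have *: "of_real (h ^ 2) * s j * nth_deriv 2 ?u (of_int j * h)
        = of_real (h ^ k) * fact k * (if k < 2 then 0 else s j * of_int j ^ (k - 2) / fact (k - 2))" for j
    proof (cases "k < 2")
      case True
      then show ?thesis
        unfolding nth_deriv_monomial by (auto simp: less_2_cases_iff numeral_2_eq_2)
    next
      case False
      then obtain i where i: "k = Suc (Suc i)"
        using add_2_eq_Suc less_eqE not_less by metis
      show ?thesis
        unfolding nth_deriv_monomial i by (simp add: numeral_2_eq_2 power_mult_distrib field_simps)
    qed
    have "(\<Sum>\<^sub>\<infinity>j. d j * ?u (of_int j * h) + of_real (h ^ 2) * s j * nth_deriv 2 ?u (of_int j * h))
      = (\<Sum>j\<in>{-int N..int N}. d j * ?u (of_int j * h) + of_real (h ^ 2) * s j * nth_deriv 2 ?u (of_int j * h))"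
      by (rule infsum_finite_support) (simp add: d s)
    also have "\<dots> = of_real (h ^ k) * M"
      unfolding * by (simp add: M_def formula_moment_def sum.distrib sum_distrib_left distrib_left
          power_mult_distrib mult_ac)
    finally show ?thesis .
  qed
  have "(\<lambda>h. \<Sum>\<^sub>\<infinity>j. d j * ?u (of_int j * h) + of_real (h ^ 2) * s j * nth_deriv 2 ?u (of_int j * h))
      \<in> O[at_right 0](\<lambda>h. complex_of_real (h ^ (n + 2)))"
    by (rule assms(3)[unfolded consistent_def, rule_format, OF smooth_monomial])
  then have "(\<lambda>h. of_real (h ^ k) * M) \<in> O[at_right 0](\<lambda>h. complex_of_real (h ^ (n + 2)))"
    unfolding defect .
  then obtain C where "\<forall>\<^sub>F h in at_right 0. norm (complex_of_real (h ^ k) * M) \<le> C * norm (complex_of_real (h ^ (n + 2)))"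
    by (elim landau_o.bigE) auto
  moreover have "\<forall>\<^sub>F h in at_right (0::real). h > 0"
    by (rule eventually_at_right_less)
  ultimately have "\<forall>\<^sub>F h in at_right 0. norm M \<le> C * h ^ (n + 2 - k)"
  proof eventually_elim
    case (elim h)
    then have "h ^ k * norm M \<le> h ^ k * (C * h ^ (n + 2 - k))"
      using k by (simp add: norm_mult norm_power mult_ac flip: power_add)
    then show ?case
      using elim by simp
  qed
  moreover have "((\<lambda>h. C * h ^ (n + 2 - k)) \<longlongrightarrow> C * 0 ^ (n + 2 - k)) (at_right (0::real))"
    by (intro tendsto_intros)
  ultimately have "norm M \<le> C * 0 ^ (n + 2 - k)"
    by (intro tendsto_lowerbound[where F = "at_right (0::real)"]) auto
  then have "M = 0"
    using k by (simp add: power_0_left)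
  then show ?thesis by (simp add: M_def)
qed

text \<open>
  The Taylor polynomials of \<open>u\<close> of degree \<open>n + 1\<close> and of \<open>u''\<close> of degree \<open>n - 1\<close> contribute a linear
  combination of vanishing moments, and both remainders are of order \<open>h^(n+2)\<close>, the second one because of
  the factor \<open>h^2\<close>.
\<close>

lemma formula_moment_imp_consistent:
  assumes d: "\<And>j. \<bar>j\<bar> > int N \<Longrightarrow> d j = 0" and s: "\<And>j. \<bar>j\<bar> > int N \<Longrightarrow> s j = 0"
    and moments: "\<And>k. k < n + 2 \<Longrightarrow> formula_moment N d s k = 0"
  shows "consistent n d s"
  unfolding consistent_def
proof (intro allI impI)
  fix u assume u: "smooth u"
  define U where "U = (\<lambda>k. nth_deriv k u 0)"
  define T1 where "T1 = (\<lambda>x::real. \<Sum>k<n + 2. U k * of_real (x ^ k) / fact k)"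
  define T2 where "T2 = (\<lambda>x::real. \<Sum>k<n. U (k + 2) * of_real (x ^ k) / fact k)"
  obtain C1 where C1: "\<And>x. \<bar>x\<bar> \<le> 1 \<Longrightarrow> norm (u x - T1 x) \<le> C1 * \<bar>x\<bar> ^ (n + 2)"
    using smooth_taylor_bound[OF u, of "n + 2"] unfolding T1_def U_def by blast
  obtain C2 where C2: "\<And>x. \<bar>x\<bar> \<le> 1 \<Longrightarrow> norm (nth_deriv 2 u x - T2 x) \<le> C2 * \<bar>x\<bar> ^ n"
    using smooth_taylor_bound[OF smooth_nth_deriv[OF u, of 2], of n] unfolding T2_def U_def nth_deriv_add by blast
  let ?S = "{-int N..int N}"
  have taylor_part: "(\<Sum>j\<in>?S. d j * T1 (of_int j * h) + of_real (h ^ 2) * s j * T2 (of_int j * h)) = 0" for h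
  proof -
    have T2: "of_real (h ^ 2) * s j * T2 (of_int j * h) =
        (\<Sum>k<n + 2. U k * of_real (h ^ k) * (if k < 2 then 0 else s j * of_int j ^ (k - 2) / fact (k - 2)))" for j
    proof -
      have shift: "(\<Sum>k<n + 2. F k) = F 0 + F 1 + (\<Sum>k<n. F (k + 2))" for F :: "nat \<Rightarrow> complex"
        by (simp add: sum.lessThan_Suc_shift add.assoc del: sum.lessThan_Suc)
      have "of_real (h ^ 2) * s j * T2 (of_int j * h) =
          (\<Sum>k<n. U (k + 2) * of_real (h ^ (k + 2)) * (s j * of_int j ^ k / fact k))"
        unfolding T2_def sum_distrib_left
        by (rule sum.cong) (simp_all add: power_mult_distrib power_add power2_eq_square mult_ac)
      then show ?thesis
        unfolding shift by simp
    qed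
    have T1: "d j * T1 (of_int j * h) = (\<Sum>k<n + 2. U k * of_real (h ^ k) * (d j * of_int j ^ k / fact k))" for j
      unfolding T1_def sum_distrib_left
      by (rule sum.cong) (simp_all add: power_mult_distrib mult_ac)
    have "(\<Sum>j\<in>?S. d j * T1 (of_int j * h) + of_real (h ^ 2) * s j * T2 (of_int j * h))
        = (\<Sum>j\<in>?S. \<Sum>k<n + 2. U k * of_real (h ^ k) * (d j * of_int j ^ k / fact k
          + (if k < 2 then 0 else s j * of_int j ^ (k - 2) / fact (k - 2))))"
      unfolding T1 T2 by (simp only: sum.distrib distrib_left)
    also have "\<dots> = (\<Sum>k<n + 2. U k * of_real (h ^ k) * formula_moment N d s k)"
    proof (subst sum.swap, rule sum.cong)
      fix k
      show "(\<Sum>j\<in>?S. U k * of_real (h ^ k) * (d j * of_int j ^ k / fact k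
          + (if k < 2 then 0 else s j * of_int j ^ (k - 2) / fact (k - 2))))
        = U k * of_real (h ^ k) * formula_moment N d s k"
        unfolding sum_distrib_left[symmetric] sum.distrib formula_moment_def by (cases "k < 2") simp_all
    qed simp
    also have "\<dots> = 0"
      using moments by simp
    finally show ?thesis .
  qed
  define C where "C = (\<Sum>j\<in>?S. norm (d j) * C1 * \<bar>of_int j\<bar> ^ (n + 2) + norm (s j) * C2 * \<bar>of_int j\<bar> ^ n)"
  have bound: "norm (\<Sum>\<^sub>\<infinity>j. d j * u (of_int j * h) + of_real (h ^ 2) * s j * nth_deriv 2 u (of_int j * h))
      \<le> C * norm (complex_of_real (h ^ (n + 2)))" if h: "0 < h" "h < 1 / (real N + 1)" for h
  proof -
    have small: "\<bar>of_int j * h\<bar> \<le> 1" if "j \<in> ?S" for j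
    proof -
      have "\<bar>of_int j\<bar> \<le> real N" using that by auto
      then have "\<bar>of_int j\<bar> * h \<le> real N * h"
        using h by (intro mult_right_mono) auto
      also have "\<dots> \<le> 1"
        using h by (simp add: field_simps)
      finally show ?thesis using h by (simp add: abs_mult)
    qed
    have "(\<Sum>\<^sub>\<infinity>j. d j * u (of_int j * h) + of_real (h ^ 2) * s j * nth_deriv 2 u (of_int j * h))
        = (\<Sum>j\<in>?S. d j * u (of_int j * h) + of_real (h ^ 2) * s j * nth_deriv 2 u (of_int j * h))"
      by (rule infsum_finite_support) (simp add: d s)
    also have "\<dots> = (\<Sum>j\<in>?S. d j * u (of_int j * h) + of_real (h ^ 2) * s j * nth_deriv 2 u (of_int j * h))
        - (\<Sum>j\<in>?S. d j * T1 (of_int j * h) + of_real (h ^ 2) * s j * T2 (of_int j * h))"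
      unfolding taylor_part by simp
    also have "\<dots> = (\<Sum>j\<in>?S. d j * (u (of_int j * h) - T1 (of_int j * h))
        + of_real (h ^ 2) * s j * (nth_deriv 2 u (of_int j * h) - T2 (of_int j * h)))"
      by (simp add: sum_subtractf[symmetric] algebra_simps)
    finally have defect: "(\<Sum>\<^sub>\<infinity>j. d j * u (of_int j * h) + of_real (h ^ 2) * s j * nth_deriv 2 u (of_int j * h))
        = (\<Sum>j\<in>?S. d j * (u (of_int j * h) - T1 (of_int j * h))
        + of_real (h ^ 2) * s j * (nth_deriv 2 u (of_int j * h) - T2 (of_int j * h)))" .
    have "norm (\<Sum>j\<in>?S. d j * (u (of_int j * h) - T1 (of_int j * h))
        + of_real (h ^ 2) * s j * (nth_deriv 2 u (of_int j * h) - T2 (of_int j * h))) \<le> (\<Sum>j\<in>?S. (norm (d j) * C1 * \<bar>of_int j\<bar> ^ (n + 2) + norm (s j) * C2 * \<bar>of_int j\<bar> ^ n) * h ^ (n + 2))"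
    proof (rule sum_norm_le)
      fix j assume j: "j \<in> ?S"
      have "norm (d j * (u (of_int j * h) - T1 (of_int j * h))
          + of_real (h ^ 2) * s j * (nth_deriv 2 u (of_int j * h) - T2 (of_int j * h)))
        \<le> norm (d j) * norm (u (of_int j * h) - T1 (of_int j * h))
          + h ^ 2 * norm (s j) * norm (nth_deriv 2 u (of_int j * h) - T2 (of_int j * h))"
        by (rule norm_triangle_le) (simp add: norm_mult norm_power)
      also have "\<dots> \<le> norm (d j) * (C1 * \<bar>of_int j * h\<bar> ^ (n + 2)) + h ^ 2 * norm (s j) * (C2 * \<bar>of_int j * h\<bar> ^ n)"
        using C1[OF small[OF j]] C2[OF small[OF j]] by (intro add_mono mult_left_mono) auto
      also have "\<dots> = (norm (d j) * C1 * \<bar>of_int j\<bar> ^ (n + 2) + norm (s j) * C2 * \<bar>of_int j\<bar> ^ n) * h ^ (n + 2)"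
        using h by (simp add: abs_mult power_mult_distrib power_add power2_eq_square algebra_simps)
      finally show "norm (d j * (u (of_int j * h) - T1 (of_int j * h))
          + of_real (h ^ 2) * s j * (nth_deriv 2 u (of_int j * h) - T2 (of_int j * h)))
        \<le> (norm (d j) * C1 * \<bar>of_int j\<bar> ^ (n + 2) + norm (s j) * C2 * \<bar>of_int j\<bar> ^ n) * h ^ (n + 2)" .
    qed
    also have "\<dots> = C * norm (complex_of_real (h ^ (n + 2)))"
      unfolding C_def sum_distrib_right[symmetric] norm_of_real using h by simp
    finally show ?thesis
      unfolding defect .
  qed
  have "\<forall>\<^sub>F h in at_right 0. h \<in> {0<..<1 / (real N + 1)}"
    by (rule eventually_at_right_real) simp
  then show "(\<lambda>h. \<Sum>\<^sub>\<infinity>j. d j * u (of_int j * h) + of_real (h ^ 2) * s j * nth_deriv 2 u (of_int j * h))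
      \<in> O[at_right 0](\<lambda>h. of_real (h ^ (n + 2)))"
    by (intro bigoI[where c = C], eventually_elim) (use bound in auto)
qed

section \<open>Symmetric formulas\<close>

definition fold_seq :: "(int \<Rightarrow> complex) \<Rightarrow> nat \<Rightarrow> complex" where
  "fold_seq d j = (if j = 0 then d 0 else 2 * d (int j))"

definition symmetric_within :: "nat \<Rightarrow> (int \<Rightarrow> complex) \<Rightarrow> bool" where
  "symmetric_within a d \<longleftrightarrow> (\<forall>j. d (- j) = d j) \<and> (\<forall>j. \<bar>j\<bar> \<ge> int a \<longrightarrow> d j = 0)"

lemma symmetric_within_sym: "symmetric_within a d \<Longrightarrow> d (- j) = d j"
  and symmetric_within_eq_0: "symmetric_within a d \<Longrightarrow> \<bar>j\<bar> \<ge> int a \<Longrightarrow> d j = 0"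
  by (simp_all add: symmetric_within_def)

lemma symmetric_within_shrink:
  assumes "symmetric_within (Suc a) d" and "d (int a) = 0"
  shows "symmetric_within a d"
  unfolding symmetric_within_def
proof (intro conjI allI impI)
  fix j
  show "d (- j) = d j"
    using assms(1) by (rule symmetric_within_sym)
  assume "\<bar>j\<bar> \<ge> int a"
  then consider "j = int a" | "j = - int a" | "\<bar>j\<bar> \<ge> int (Suc a)"
    by linarith
  then show "d j = 0"
    using assms symmetric_within_sym[OF assms(1), of "int a"] symmetric_within_eq_0[OF assms(1)] by cases auto
qed

lemma sum_symmetric_fold:
  assumes d: "symmetric_within a d" and even: "\<And>j. g (- j) = g j" and "a \<le> Suc N"
  shows "(\<Sum>j\<in>{-int N..int N}. d j * g j) = (\<Sum>j<a. fold_seq d j * g (int j))"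
proof -
  note sym = symmetric_within_sym[OF d] and supp = symmetric_within_eq_0[OF d]
  have "(\<Sum>j\<in>{-int M..int M}. d j * g j) = (\<Sum>j<Suc M. fold_seq d j * g (int j))" for M
  proof (induction M)
    case 0
    show ?case by (simp add: fold_seq_def)
  next
    case (Suc M)
    have "{-int (Suc M)..int (Suc M)} = insert (- int (Suc M)) (insert (int (Suc M)) {-int M..int M})"
      by auto
    then have "(\<Sum>j\<in>{-int (Suc M)..int (Suc M)}. d j * g j)
        = d (- int (Suc M)) * g (- int (Suc M)) + (d (int (Suc M)) * g (int (Suc M))
          + (\<Sum>j\<in>{-int M..int M}. d j * g j))"
      by (simp del: of_nat_Suc)
    also have "\<dots> = (\<Sum>j<Suc (Suc M). fold_seq d j * g (int j))"
      unfolding Suc sym even sum.lessThan_Suc[of _ "Suc M"] by (simp add: fold_seq_def del: of_nat_Suc sum.lessThan_Suc)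
    finally show ?case .
  qed
  also have "(\<Sum>j<Suc N. fold_seq d j * g (int j)) = (\<Sum>j<a. fold_seq d j * g (int j))"
    by (rule sum.mono_neutral_right) (use \<open>a \<le> Suc N\<close> supp in \<open>auto simp: fold_seq_def\<close>)
  finally show ?thesis .
qed

lemma sum_symmetric_odd:
  fixes d g :: "int \<Rightarrow> complex"
  assumes "\<And>j. d (- j) = d j" and "\<And>j. g (- j) = - g j"
  shows "(\<Sum>j\<in>{-int N..int N}. d j * g j) = 0"
proof -
  have "(\<Sum>j\<in>{-int N..int N}. d j * g j) = (\<Sum>j\<in>{-int N..int N}. d (- j) * g (- j))"
    by (rule sum.reindex_bij_witness[where i = uminus and j = uminus]) auto
  also have "\<dots> = - (\<Sum>j\<in>{-int N..int N}. d j * g j)"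
    by (simp add: assms sum_negf)
  finally show ?thesis by simp
qed

lemma formula_moment_even:
  assumes "symmetric_within a d" "symmetric_within b s" "a \<le> Suc N" "b \<le> Suc N"
  shows "formula_moment N d s (2 * k) = even_moment a b (fold_seq d) (fold_seq s) k"
proof -
  have d: "(\<Sum>j\<in>{-int N..int N}. d j * (of_int j ^ (2 * i) / fact (2 * i)))
      = (\<Sum>j<a. fold_seq d j * (of_int (int j) ^ (2 * i) / fact (2 * i)))" for i
    using assms by (intro sum_symmetric_fold) auto
  have s: "(\<Sum>j\<in>{-int N..int N}. s j * (of_int j ^ (2 * i) / fact (2 * i)))
      = (\<Sum>j<b. fold_seq s j * (of_int (int j) ^ (2 * i) / fact (2 * i)))" for i
    using assms by (intro sum_symmetric_fold) auto
  show ?thesis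
  proof (cases k)
    case 0
    then show ?thesis using d[of 0] by (simp add: formula_moment_def even_moment_def)
  next
    case (Suc i)
    then show ?thesis
      using d[of k] s[of i] by (simp add: formula_moment_def even_moment_def del: fact_Suc)
  qed
qed

lemma formula_moment_odd:
  assumes "\<And>j. d (- j) = d j" "\<And>j. s (- j) = s j" and "odd k"
  shows "formula_moment N d s k = 0"
proof -
  have "(\<Sum>j\<in>{-int N..int N}. d j * (of_int j ^ i / fact i)) = 0" "(\<Sum>j\<in>{-int N..int N}. s j * (of_int j ^ i / fact i)) = 0"
    if "odd i" for i
    by (rule sum_symmetric_odd; use assms that in simp)+
  from this(1)[of k] this(2)[of "k - 2"] \<open>odd k\<close> show ?thesis
    by (auto simp: formula_moment_def)
qed

lemma consistent_iff_even_moments: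
  assumes d: "symmetric_within a d" and s: "symmetric_within b s" and "even n"
  shows "consistent n d s \<longleftrightarrow> (\<forall>k. 2 * k \<le> n \<longrightarrow> even_moment a b (fold_seq d) (fold_seq s) k = 0)"
proof -
  define N where "N = max a b"
  have d': "d j = 0" and s': "s j = 0" if "\<bar>j\<bar> > int N" for j
    using that symmetric_within_eq_0[OF d] symmetric_within_eq_0[OF s] by (auto simp: N_def)
  have even: "formula_moment N d s (2 * k) = even_moment a b (fold_seq d) (fold_seq s) k" for k
    by (rule formula_moment_even) (use assms in \<open>auto simp: N_def\<close>)
  have "consistent n d s \<longleftrightarrow> (\<forall>k<n + 2. formula_moment N d s k = 0)"
    using consistent_imp_formula_moment[of N d s n] formula_moment_imp_consistent[of N d s n] d' s' by blast
  also have "\<dots> \<longleftrightarrow> (\<forall>k. 2 * k \<le> n \<longrightarrow> formula_moment N d s (2 * k) = 0)"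
  proof (intro iffI allI impI)
    fix k assume "\<forall>k<n + 2. formula_moment N d s k = 0" "2 * k \<le> n"
    then show "formula_moment N d s (2 * k) = 0" by simp
  next
    fix k assume *: "\<forall>k. 2 * k \<le> n \<longrightarrow> formula_moment N d s (2 * k) = 0" and "k < n + 2"
    show "formula_moment N d s k = 0"
    proof (cases "even k")
      case True
      then obtain i where i: "k = 2 * i" by blast
      then have "2 * i \<le> n" using \<open>k < n + 2\<close> \<open>even n\<close> by presburger
      then show ?thesis using * i by simp
    next
      case False
      then show ?thesis using symmetric_within_sym[OF d] symmetric_within_sym[OF s] by (intro formula_moment_odd)
    qed
  qed
  finally show ?thesis by (simp only: even)
qed

lemma even_moment_Re: "Re (even_moment a b x y k) = even_moment a b (\<lambda>j. Re (x j)) (\<lambda>j. Re (y j)) k"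
  and even_moment_Im: "Im (even_moment a b x y k) = even_moment a b (\<lambda>j. Im (x j)) (\<lambda>j. Im (y j)) k"
proof -
  have "Re (z * of_nat p / of_nat q) = Re z * of_nat p / of_nat q"
    and "Im (z * of_nat p / of_nat q) = Im z * of_nat p / of_nat q" for z :: complex and p q
    by simp_all
  note parts = this
  show "Re (even_moment a b x y k) = even_moment a b (\<lambda>j. Re (x j)) (\<lambda>j. Re (y j)) k"
    and "Im (even_moment a b x y k) = even_moment a b (\<lambda>j. Im (x j)) (\<lambda>j. Im (y j)) k"
    unfolding even_moment_def by (cases "k = 0"; simp add: parts del: of_nat_power of_nat_fact)+
qed

lemma even_moment_linear:
  "even_moment a b (\<lambda>j. x j - c * x' j) (\<lambda>j. y j - c * y' j) k = even_moment a b x y k - c * even_moment a b x' y' k"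
proof -
  have "(\<Sum>j<n. (z j - c * z' j) * p j / q) = (\<Sum>j<n. z j * p j / q) - c * (\<Sum>j<n. z' j * p j / q)"
    for n and z z' p :: "nat \<Rightarrow> 'a" and q
    by (simp add: sum_distrib_left diff_divide_distrib left_diff_distrib sum_subtractf mult.assoc)
  then show ?thesis
    by (simp add: even_moment_def right_diff_distrib distrib_left del: of_nat_power of_nat_fact)
qed

lemma even_moment_of_rat:
  "even_moment a b (\<lambda>j. of_rat (x j)) (\<lambda>j. of_rat (y j)) k = of_rat (even_moment a b x y k)"
  by (simp add: even_moment_def of_rat_sum of_rat_mult of_rat_divide of_rat_add del: of_nat_power of_nat_fact)

lemma symmetric_eq_0:
  assumes d: "symmetric_within a d" and "\<forall>j<a. fold_seq d j = 0"
  shows "d = (\<lambda>_. 0)"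
proof
  fix j
  have "d (int i) = 0" for i
    using symmetric_within_eq_0[OF d, of "int i"] assms(2)[rule_format, of i] by (cases "i < a") (auto simp: fold_seq_def split: if_splits)
  from this[of "nat \<bar>j\<bar>"] show "d j = 0"
    using symmetric_within_sym[OF d, of j] by (cases "j \<ge> 0") auto
qed

text \<open>
  The real and imaginary parts of the weights satisfy the same real moment equations, so rigidity over the reals suffices.
\<close>

lemma consistent_order_bound:
  assumes ds: "symmetric_within a d" "symmetric_within b s"
    and "a \<ge> 1" "even n" "2 * (a + b - 1) \<le> n" and cons: "consistent n d s"
  shows "d = (\<lambda>_. 0) \<and> s = (\<lambda>_. 0)"
proof -
  have "even_moment a b (fold_seq d) (fold_seq s) k = 0" if "k < a + b" for k
    using consistent_iff_even_moments[OF ds \<open>even n\<close>] cons assms(5) that by auto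
  then have "even_moment a b (\<lambda>j. Re (fold_seq d j)) (\<lambda>j. Re (fold_seq s j)) k = 0"
    and "even_moment a b (\<lambda>j. Im (fold_seq d j)) (\<lambda>j. Im (fold_seq s j)) k = 0" if "k < a + b" for k
    using that by (simp_all flip: even_moment_Re even_moment_Im)
  from even_moments_determine[OF \<open>a \<ge> 1\<close> this(1)] even_moments_determine[OF \<open>a \<ge> 1\<close> this(2)]
  have "\<forall>j<a. fold_seq d j = 0" "\<forall>j<b. fold_seq s j = 0"
    by (auto simp: complex_eq_iff)
  then show ?thesis
    using symmetric_eq_0[OF ds(1)] symmetric_eq_0[OF ds(2)] by auto
qed

lemma consistent_sum_zero:
  assumes ds: "symmetric_within a d" "symmetric_within b s"
    and "a \<ge> 2" "b \<ge> 1" and moments: "\<And>k. k < a + b - 1 \<Longrightarrow> even_moment a b (fold_seq d) (fold_seq s) k = 0"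
    and sum: "(\<Sum>j<b. fold_seq s j) = 0"
  shows "d = (\<lambda>_. 0) \<and> s = (\<lambda>_. 0)"
proof -
  have "even_moment a b (\<lambda>j. Re (fold_seq d j)) (\<lambda>j. Re (fold_seq s j)) k = 0"
    and "even_moment a b (\<lambda>j. Im (fold_seq d j)) (\<lambda>j. Im (fold_seq s j)) k = 0" if "k < a + b - 1" for k
    using moments that by (simp_all flip: even_moment_Re even_moment_Im)
  note real_moments = this
  have "(\<Sum>j<b. Re (fold_seq s j)) = 0" "(\<Sum>j<b. Im (fold_seq s j)) = 0"
    using sum by (simp_all flip: Re_sum Im_sum)
  with even_moments_sum_determine[OF \<open>a \<ge> 2\<close> \<open>b \<ge> 1\<close> real_moments(1)]
    even_moments_sum_determine[OF \<open>a \<ge> 2\<close> \<open>b \<ge> 1\<close> real_moments(2)]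
  have "\<forall>j<a. fold_seq d j = 0" "\<forall>j<b. fold_seq s j = 0"
    by (auto simp: complex_eq_iff)
  then show ?thesis
    using symmetric_eq_0[OF ds(1)] symmetric_eq_0[OF ds(2)] by auto
qed

section \<open>A rational solution\<close>

text \<open>
  Gaussian elimination: an equation with a nonzero coefficient is used to eliminate one unknown from the others.
\<close>

lemma underdetermined_homogeneous_system:
  fixes A :: "'i \<Rightarrow> 'j \<Rightarrow> 'a::field"
  assumes "finite I" "finite J" "card I < card J"
  shows "\<exists>x. (\<exists>j\<in>J. x j \<noteq> 0) \<and> (\<forall>i\<in>I. (\<Sum>j\<in>J. A i j * x j) = 0)"
  using assms
proof (induction I arbitrary: A J rule: finite_induct)
  case empty
  then have "J \<noteq> {}" by auto
  then show ?case by (auto intro!: exI[of _ "\<lambda>_. 1"])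
next
  case (insert r I)
  show ?case
  proof (cases "\<forall>j\<in>J. A r j = 0")
    case True
    obtain x where "\<exists>j\<in>J. x j \<noteq> 0" "\<forall>i\<in>I. (\<Sum>j\<in>J. A i j * x j) = 0"
      using insert.IH[of J A] insert.prems insert.hyps by auto
    then show ?thesis using True by (intro exI[of _ x]) auto
  next
    case False
    then obtain p where p: "p \<in> J" "A r p \<noteq> 0" by auto
    define J' where "J' = J - {p}"
    have J: "J = insert p J'" "p \<notin> J'" "finite J'"
      using p insert.prems by (auto simp: J'_def)
    obtain x where x: "\<exists>j\<in>J'. x j \<noteq> 0"
        "\<forall>i\<in>I. (\<Sum>j\<in>J'. (A i j - A i p * A r j / A r p) * x j) = 0"
      using insert.IH[of J' "\<lambda>i j. A i j - A i p * A r j / A r p"] insert.prems insert.hyps J by auto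
    define x' where "x' = x(p := - (\<Sum>j\<in>J'. A r j * x j) / A r p)"
    have split: "(\<Sum>j\<in>J. A i j * x' j) = A i p * x' p + (\<Sum>j\<in>J'. A i j * x j)" for i
    proof -
      have "(\<Sum>j\<in>J'. A i j * x' j) = (\<Sum>j\<in>J'. A i j * x j)"
        by (rule sum.cong) (use J in \<open>auto simp: x'_def\<close>)
      then show ?thesis using J by simp
    qed
    have "(\<Sum>j\<in>J. A i j * x' j) = 0" if "i \<in> insert r I" for i
    proof (cases "i = r")
      case True
      then show ?thesis unfolding split using p by (simp add: x'_def)
    next
      case False
      then have "0 = (\<Sum>j\<in>J'. (A i j - A i p * A r j / A r p) * x j)"
        using that x(2) by auto
      also have "\<dots> = (\<Sum>j\<in>J'. A i j * x j) - A i p / A r p * (\<Sum>j\<in>J'. A r j * x j)"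
        unfolding sum_distrib_left sum_subtractf[symmetric] by (rule sum.cong) (simp_all add: left_diff_distrib)
      finally show ?thesis
        unfolding split by (simp add: x'_def)
    qed
    moreover have "\<exists>j\<in>J. x' j \<noteq> 0"
      using x(1) J by (auto simp: x'_def)
    ultimately show ?thesis by blast
  qed
qed

text \<open>
  There is one unknown more than there are equations, which gives a nonzero solution. The sum of its \<open>y\<^sub>j\<close> is
  nonzero by rigidity, and hence can be scaled to 1.
\<close>

lemma rational_even_moment_solution:
  assumes "a \<ge> 2" "b \<ge> 1"
  obtains x y :: "nat \<Rightarrow> rat"
  where "\<And>k. k < a + b - 1 \<Longrightarrow> even_moment a b x y k = 0" and "(\<Sum>j<b. y j) = 1"
proof -
  define A :: "nat \<Rightarrow> nat \<Rightarrow> rat" where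
    "A k j = (if j < a then of_nat (j ^ (2 * k)) / of_nat (fact (2 * k))
      else if k = 0 then 0 else of_nat ((j - a) ^ (2 * k - 2)) / of_nat (fact (2 * k - 2)))" for k j
  obtain z where z: "\<exists>j\<in>{..<a + b}. z j \<noteq> 0" "\<forall>k\<in>{..<a + b - 1}. (\<Sum>j<a + b. A k j * z j) = 0"
    using underdetermined_homogeneous_system[of "{..<a + b - 1}" "{..<a + b}" A] assms by auto
  define y where "y = (\<lambda>j. z (a + j))"
  have moments: "even_moment a b z y k = 0" if "k < a + b - 1" for k
  proof -
    have "(\<Sum>j<a + b. A k j * z j) = (\<Sum>j<a. A k j * z j) + (\<Sum>j<b. A k (a + j) * z (a + j))"
      by (induction b) (simp_all add: algebra_simps)
    also have "\<dots> = even_moment a b z y k"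
      by (auto simp: even_moment_def A_def y_def mult_ac intro!: sum.cong arg_cong2[where f = "(+)"])
    finally show ?thesis using z(2) that by simp
  qed
  have "(\<Sum>j<b. y j) \<noteq> 0"
  proof
    assume "(\<Sum>j<b. y j) = 0"
    then have "(\<Sum>j<b. real_of_rat (y j)) = 0"
      by (simp flip: of_rat_sum)
    then have "(\<forall>j<a. real_of_rat (z j) = 0) \<and> (\<forall>j<b. real_of_rat (y j) = 0)"
      using moments by (intro even_moments_sum_determine assms) (simp_all add: even_moment_of_rat)
    moreover have "j < a \<or> (\<exists>i<b. j = a + i)" if "j < a + b" for j
      using that by presburger
    ultimately have "\<forall>j<a + b. z j = 0"
      by (auto simp: y_def)
    then show False using z(1) by auto
  qed
  define c where "c = 1 / (\<Sum>j<b. y j)"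
  show thesis
  proof (rule that[of "\<lambda>j. c * z j" "\<lambda>j. c * y j"])
    show "even_moment a b (\<lambda>j. c * z j) (\<lambda>j. c * y j) k = 0" if "k < a + b - 1" for k
      using even_moment_linear[of a b "\<lambda>_. 0" "- c" z "\<lambda>_. 0" y k] moments[OF that]
      by (simp add: even_moment_def)
    show "(\<Sum>j<b. c * y j) = 1"
      using \<open>(\<Sum>j<b. y j) \<noteq> 0\<close> unfolding sum_distrib_left[symmetric] by (simp add: c_def)
  qed
qed

text \<open>
  A right inverse of \<open>fold_seq\<close>: the weight of a positive node is shared equally with its mirror image.
\<close>

definition unfold_seq :: "nat \<Rightarrow> (nat \<Rightarrow> rat) \<Rightarrow> int \<Rightarrow> complex" where
  "unfold_seq a x j = (if \<bar>j\<bar> < int a then of_rat (if j = 0 then x 0 else x (nat \<bar>j\<bar>) / 2) else 0)"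

lemma unfold_seq:
  shows symmetric_within_unfold_seq: "symmetric_within a (unfold_seq a x)"
    and fold_unfold_seq: "i < a \<Longrightarrow> fold_seq (unfold_seq a x) i = of_rat (x i)"
    and unfold_seq_sym_formulas: "unfold_seq a x \<in> sym_formulas \<rat>"
proof -
  have "{j. unfold_seq a x j \<noteq> 0} \<subseteq> {-int a..int a}"
    by (auto simp: unfold_seq_def)
  then have "finite {j. unfold_seq a x j \<noteq> 0}"
    using finite_subset by blast
  then show "unfold_seq a x \<in> sym_formulas \<rat>"
    by (auto simp: sym_formulas_def unfold_seq_def)
qed (auto simp: symmetric_within_def unfold_seq_def fold_seq_def of_rat_divide)

section \<open>Radius, exact order and the optimal formulas\<close>

lemma tau_le_iff:
  assumes "d \<in> sym_formulas R"
  shows "tau d \<le> ereal (real N) \<longleftrightarrow> symmetric_within (Suc N) d"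
proof (cases "d = (\<lambda>_. 0)")
  case False
  define S where "S = {j. d j \<noteq> 0}"
  have S: "finite S" "S \<noteq> {}"
    using assms False by (auto simp: sym_formulas_def S_def)
  have sym: "d \<bar>j\<bar> = d j" for j
    using assms by (auto simp: sym_formulas_def abs_if)
  have "tau d \<le> ereal (real N) \<longleftrightarrow> real_of_int (Max S) \<le> real_of_int (int N)"
    using False by (simp add: tau_def S_def)
  also have "\<dots> \<longleftrightarrow> (\<forall>j\<in>S. j \<le> int N)"
    unfolding of_int_le_iff using S by simp
  also have "\<dots> \<longleftrightarrow> (\<forall>j. \<bar>j\<bar> \<ge> int (Suc N) \<longrightarrow> d j = 0)"
  proof (intro iffI allI impI ballI)
    fix j assume *: "\<forall>j\<in>S. j \<le> int N" "\<bar>j\<bar> \<ge> int (Suc N)"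
    then have "\<bar>j\<bar> \<notin> S" by auto
    then show "d j = 0" using sym[of j] by (simp add: S_def)
  next
    fix j assume "\<forall>j. \<bar>j\<bar> \<ge> int (Suc N) \<longrightarrow> d j = 0" "j \<in> S"
    then show "j \<le> int N" by (force simp: S_def)
  qed
  finally show ?thesis
    using assms by (simp add: symmetric_within_def sym_formulas_def)
qed (simp add: tau_def symmetric_within_def)

lemma tau_eqI:
  assumes "d \<in> sym_formulas R" and "symmetric_within (Suc N) d" and "d (int N) \<noteq> 0"
  shows "tau d = ereal (real N)"
proof (rule antisym)
  show "tau d \<le> ereal (real N)"
    using tau_le_iff[OF assms(1)] assms(2) by blast
  have "int N \<le> Max {j. d j \<noteq> 0}"
    using assms(1,3) by (intro Max_ge) (auto simp: sym_formulas_def)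
  then have "real_of_int (int N) \<le> real_of_int (Max {j. d j \<noteq> 0})"
    unfolding of_int_le_iff .
  moreover have "d \<noteq> (\<lambda>_. 0)"
    using assms(3) by auto
  ultimately show "ereal (real N) \<le> tau d"
    by (simp add: tau_def)
qed

lemma le_exact_ord: "even n \<Longrightarrow> consistent n d s \<Longrightarrow> ereal (real n) \<le> exact_ord d s"
  unfolding exact_ord_def by (intro SUP_upper) auto

lemma exact_ord_le:
  assumes "\<And>n. even n \<Longrightarrow> consistent n d s \<Longrightarrow> n \<le> N"
  shows "exact_ord d s \<le> ereal (real N)"
  unfolding exact_ord_def by (intro SUP_least) (use assms in auto)

lemma exact_ord_eqD:
  assumes "exact_ord d s = ereal (real N)" "N > 0"
  shows "\<exists>n. even n \<and> consistent n d s \<and> N \<le> n"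
proof (rule ccontr)
  assume "\<not> ?thesis"
  then have "n \<le> N - 1" if "even n" "consistent n d s" for n
    using that by force
  then have "exact_ord d s \<le> ereal (real (N - 1))"
    by (rule exact_ord_le)
  then show False using assms by simp
qed

theorem theorem2p7:
  fixes l m :: nat
  shows "\<exists>D\<in>sym_formulas \<rat>. \<exists>S\<in>sym_formulas \<rat>.
    tau D = ereal (real (l + 1)) \<and> tau S = ereal (real m) \<and>
    (\<Sum>\<^sub>\<infinity>j. D j * of_int (j ^ 2)) = - 2 \<and>
    is_arg_max (\<lambda>(d, s). exact_ord d s) (\<lambda>p. p \<in> admissible l m) (D, S) \<and>
    exact_ord D S = ereal (real (2 * (l + m + 1))) \<and>
    (\<forall>d\<in>sym_formulas UNIV. \<forall>s\<in>sym_formulas UNIV.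
       tau d \<le> ereal (real (l + 1)) \<longrightarrow> tau s \<le> ereal (real m) \<longrightarrow>
       exact_ord d s = ereal (real (2 * (l + m + 1))) \<longrightarrow>
       (\<exists>c::complex. d = (\<lambda>j. c * D j) \<and> s = (\<lambda>j. c * S j)))"
proof -
  define a b where "a = l + 2" and "b = m + 1"
  obtain x y :: "nat \<Rightarrow> rat" where
    xy: "\<And>k. k < a + b - 1 \<Longrightarrow> even_moment a b x y k = 0" "(\<Sum>j<b. y j) = 1"
    using rational_even_moment_solution[of a b] by (auto simp: a_def b_def)
  define D S where "D = unfold_seq a x" and "S = unfold_seq b y"
  have D_rat: "D \<in> sym_formulas \<rat>" and S_rat: "S \<in> sym_formulas \<rat>"
    by (simp_all add: D_def S_def unfold_seq_sym_formulas)
  have D: "symmetric_within a D" and S: "symmetric_within b S"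
    by (simp_all add: D_def S_def symmetric_within_unfold_seq)
  have DS_moments: "even_moment a b (fold_seq D) (fold_seq S) k = 0" if "k < a + b - 1" for k
  proof -
    have "even_moment a b (fold_seq D) (fold_seq S) k = even_moment a b (\<lambda>j. of_rat (x j)) (\<lambda>j. of_rat (y j)) k"
      by (simp add: even_moment_def D_def S_def fold_unfold_seq)
    then show ?thesis
      using xy(1)[OF that] by (simp add: even_moment_of_rat)
  qed
  have sum_S: "(\<Sum>j<b. fold_seq S j) = 1"
    using xy(2) by (simp add: S_def fold_unfold_seq flip: of_rat_sum)
  have nonzero: "S \<noteq> (\<lambda>_. 0)"
  proof
    assume "S = (\<lambda>_. 0)"
    then have "fold_seq S j = 0" for j
      by (simp add: fold_seq_def)
    then show False
      using sum_S by simp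
  qed
  have cons: "consistent (2 * (l + m + 1)) D S"
    using consistent_iff_even_moments[OF D S] DS_moments by (auto simp: a_def b_def)

  have order_le: "n \<le> 2 * (l + m + 1)" if "(d, s) \<in> admissible l m" "even n" "consistent n d s" for d s n
  proof (rule ccontr)
    assume "\<not> ?thesis"
    then have n: "2 * (a + b - 1) \<le> n"
      using \<open>even n\<close> unfolding a_def b_def by presburger
    have ds: "d \<in> sym_formulas UNIV" "s \<in> sym_formulas UNIV"
      and tau: "tau d \<le> ereal (real (l + 1))" "tau s \<le> ereal (real m)"
      and "\<not> (d = (\<lambda>_. 0) \<and> s = (\<lambda>_. 0))"
      using that(1) unfolding admissible_def by auto
    moreover have "symmetric_within a d" "symmetric_within b s"
      using tau unfolding tau_le_iff[OF ds(1)] tau_le_iff[OF ds(2)] by (simp_all add: a_def b_def)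
    then have "d = (\<lambda>_. 0) \<and> s = (\<lambda>_. 0)"
      by (rule consistent_order_bound[OF _ _ _ \<open>even n\<close> n \<open>consistent n d s\<close>]) (simp add: a_def)
    ultimately show False
      by blast
  qed

  \<comment> \<open>If an extreme weight were zero, the pair would solve as many equations as it has free weights.\<close>
  have "D (int (l + 1)) \<noteq> 0"
  proof
    assume top: "D (int (l + 1)) = 0"
    then have "symmetric_within (l + 1) D"
      using symmetric_within_shrink[of "l + 1" D] D by (simp add: a_def)
    then show False
      using consistent_order_bound[OF _ S _ _ _ cons, of "l + 1"] nonzero by (auto simp: b_def)
  qed
  then have tau_D: "tau D = ereal (real (l + 1))"
    using D_rat D by (intro tau_eqI) (auto simp: a_def)
  have "S (int m) \<noteq> 0"
  proof
    assume top: "S (int m) = 0"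
    then have "symmetric_within m S"
      using symmetric_within_shrink[of m S] S by (simp add: b_def)
    then show False
      using consistent_order_bound[OF D _ _ _ _ cons, of m] nonzero by (auto simp: a_def)
  qed
  then have tau_S: "tau S = ereal (real m)"
    using S_rat S by (intro tau_eqI) (auto simp: b_def)

  have D_adm: "(D, S) \<in> admissible l m"
    using D_rat S_rat tau_D tau_S nonzero by (auto simp: admissible_def sym_formulas_def)
  have ord_le: "exact_ord d s \<le> ereal (real (2 * (l + m + 1)))" if "(d, s) \<in> admissible l m" for d s
    using order_le[OF that] by (rule exact_ord_le)
  have ord_DS: "exact_ord D S = ereal (real (2 * (l + m + 1)))"
    by (rule antisym[OF ord_le[OF D_adm] le_exact_ord[OF _ cons]]) simp
  have arg_max: "is_arg_max (\<lambda>(d, s). exact_ord d s) (\<lambda>p. p \<in> admissible l m) (D, S)"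
    unfolding is_arg_max_def using D_adm ord_le ord_DS by (auto simp: not_less)

  \<comment> \<open>the even moment with index 1 relates the second moment of \<open>D\<close> to the sum of \<open>S\<close>\<close>
  have "(\<Sum>\<^sub>\<infinity>j. D j * of_int (j ^ 2)) = (\<Sum>j\<in>{-int a..int a}. D j * of_int (j ^ 2))"
    by (rule infsum_finite_support) (simp add: symmetric_within_eq_0[OF D])
  also have "\<dots> = (\<Sum>j<a. fold_seq D j * of_int (int j ^ 2))"
    by (rule sum_symmetric_fold) (use D in auto)
  also have "\<dots> = 2 * (even_moment a b (fold_seq D) (fold_seq S) 1 - (\<Sum>j<b. fold_seq S j))"
    by (simp add: even_moment_def numeral_2_eq_2 flip: sum_divide_distrib)
  also have "\<dots> = - 2"
    using DS_moments[of 1] sum_S by (simp add: a_def b_def)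
  finally have second_moment: "(\<Sum>\<^sub>\<infinity>j. D j * of_int (j ^ 2)) = - 2" .

  have unique: "\<exists>c::complex. d = (\<lambda>j. c * D j) \<and> s = (\<lambda>j. c * S j)"
    if ds: "d \<in> sym_formulas UNIV" "s \<in> sym_formulas UNIV"
      and tau: "tau d \<le> ereal (real (l + 1))" "tau s \<le> ereal (real m)"
      and ord: "exact_ord d s = ereal (real (2 * (l + m + 1)))" for d s
  proof -
    have d: "symmetric_within a d" and s: "symmetric_within b s"
      using tau unfolding tau_le_iff[OF ds(1)] tau_le_iff[OF ds(2)] by (simp_all add: a_def b_def)
    obtain n where n: "even n" "consistent n d s" "2 * (l + m + 1) \<le> n"
      using exact_ord_eqD[OF ord] by auto
    have ds_moments: "even_moment a b (fold_seq d) (fold_seq s) k = 0" if "k < a + b - 1" for k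
      using consistent_iff_even_moments[OF d s n(1)] n(2,3) that by (auto simp: a_def b_def)
    \<comment> \<open>As \<open>\<Sum>\<^sub>j S\<^sub>j = 1\<close>, this multiple of \<open>S\<close> has the same sum as \<open>s\<close>, so the sum of the difference vanishes.\<close>
    define c where "c = (\<Sum>j<b. fold_seq s j)"
    have fold: "fold_seq (\<lambda>j. u j - c * v j) = (\<lambda>j. fold_seq u j - c * fold_seq v j)" for u v
      by (auto simp: fold_seq_def algebra_simps)
    have "(\<lambda>j. d j - c * D j) = (\<lambda>_. 0) \<and> (\<lambda>j. s j - c * S j) = (\<lambda>_. 0)"
    proof (rule consistent_sum_zero[where a = a and b = b])
      show "even_moment a b (fold_seq (\<lambda>j. d j - c * D j)) (fold_seq (\<lambda>j. s j - c * S j)) k = 0"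
        if "k < a + b - 1" for k
        unfolding fold even_moment_linear using DS_moments[OF that] ds_moments[OF that] by simp
      show "(\<Sum>j<b. fold_seq (\<lambda>j. s j - c * S j) j) = 0"
        unfolding fold by (simp add: sum_subtractf sum_S c_def flip: sum_distrib_left)
    qed (use D S d s in \<open>auto simp: symmetric_within_def a_def b_def\<close>)
    then show ?thesis
      by (intro exI[of _ c]) (auto simp: fun_eq_iff)
  qed
  show ?thesis
    using D_rat S_rat tau_D tau_S second_moment arg_max ord_DS unique by blast
qed

end
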